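(* The following identities of formal power series hold: $$\sum_{n,j,k \geq 0}Q_{n,j,k}(\mathbf x)\,t^jr^kz^n=\frac{(1-t)H(rz)}{H(zt)-tH(z)}= \frac{H(rz)}{1-\sum_{n\ge 2}t[n-1]_t\, h_n z^n}.$$
   Context: For $n\ge1$, $\mathfrak S_n$ is the symmetric group on $[n]=\{1,\dots,n\}$, and $\sigma\in\mathfrak S_n$ is written $\sigma_1\cdots\sigma_n$ with $\sigma_i=\sigma(i)$. $\mathrm{EXC}(\sigma)=\{i\in[n-1]:\sigma_i>i\}$, $\mathrm{exc}(\sigma)=|\mathrm{EXC}(\sigma)|$, and $\mathrm{fix}(\sigma)$ is the number of fixed points. Totally order the alphabet $[n]\cup\{\bar1,\dots,\bar n\}$ by $\bar1<\cdots<\bar n<1<\cdots<n$. Let $\bar\sigma$ be the word obtained from $\sigma_1\cdots\sigma_n$ by replacing $\sigma_i$ with $\overline{\sigma_i}$ for each $i\in\mathrm{EXC}(\sigma)$, and let $\mathrm{DEX}(\sigma)$ be the set of $i\in[n-1]$ such that the $i$th letter of $\bar\sigma$ is larger than the $(i+1)$st. For $S\subseteq[n-1]$, the fundamental quasisymmetric function is $F_{S,n}(\mathbf x)=\sum x_{i_1}\cdots x_{i_n}$, summed over all $i_1\ge\cdots\ge i_n\ge1$ with $i_j>i_{j+1}$ whenever $j\in S$. For $n\ge 1$ and $j,k\ge0$, $Q_{n,j,k}(\mathbf x)=\sum F_{\mathrm{DEX}(\sigma),n}(\mathbf x)$, summed over $\sigma\in\mathfrak S_n$ with $\mathrm{exc}(\sigma)=j$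 and $\mathrm{fix}(\sigma)=k$; also $Q_{0,0,0}=1$ and $Q_{0,j,k}=0$ for $(j,k)\ne(0,0)$. $h_n=h_n(\mathbf x)$ is the complete homogeneous symmetric function, $H(z)=\sum_{n\ge0}h_n z^n$, and $[m]_t=1+t+\cdots+t^{m-1}$. *)

theory Defs
  imports
    "HOL-Computational_Algebra.Formal_Power_Series"
    "HOL-Library.Multiset"
    "HOL-Library.FuncSet"
    "HOL-Combinatorics.Permutations"
begin

section \<open>Formal power series in arbitrarily many variables\<close>

text \<open>
  Monomials in variables indexed by \<^typ>\<open>'v\<close> are finite multisets over \<^typ>\<open>'v\<close>
  (the multiplicity is the exponent). A power series is an arbitrary family of
  coefficients indexed by the monomials.
\<close>

typedef (overloaded) ('v, 'a) mfps = "UNIV :: ('v multiset \<Rightarrow> 'a) set"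
  morphisms mcoeff Abs_mfps
  by simp

setup_lifting type_definition_mfps

lemma mfps_eqI: "(\<And>m. mcoeff f m = mcoeff g m) \<Longrightarrow> f = g"
  by transfer auto

lemma mcoeff_Abs_mfps [simp]: "mcoeff (Abs_mfps f) = f"
  by (simp add: Abs_mfps_inverse)

lemma finite_submultisets: "finite {A. A \<subseteq># M}"
proof (induction M)
  case empty
  then show ?case by simp
next
  case (add x M)
  have "{A. A \<subseteq># add_mset x M} \<subseteq> {A. A \<subseteq># M} \<union> add_mset x ` {A. A \<subseteq># M}"
  proof
    fix A assume A: "A \<in> {A. A \<subseteq># add_mset x M}"
    show "A \<in> {A. A \<subseteq># M} \<union> add_mset x ` {A. A \<subseteq># M}"
    proof (cases "x \<in># A")
      case True
      then obtain B where "A = add_mset x B" by (metis insert_DiffM)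
      with A show ?thesis by auto
    next
      case False
      moreover from A have "A - {#x#} \<subseteq># M"
        by (simp add: subset_eq_diff_conv)
      ultimately have "A \<subseteq># M" by (simp add: diff_single_trivial)
      then show ?thesis by simp
    qed
  qed
  then show ?case using add by (auto intro: finite_subset)
qed

lemma finite_mset_splits [simp]: "finite {(a, b). a + b = (m :: 'v multiset)}"
proof (rule finite_subset)
  show "{(a, b). a + b = m} \<subseteq> {A. A \<subseteq># m} \<times> {A. A \<subseteq># m}" by auto
qed (simp add: finite_submultisets)

instantiation mfps :: (type, comm_ring_1) comm_ring_1
begin

lift_definition zero_mfps :: "('a, 'b) mfps" is "\<lambda>_. 0" .
lift_definition one_mfps :: "('a, 'b) mfps" is "\<lambda>m. if m = {#} then 1 else 0" .
lift_definition plus_mfps :: "('a, 'b) mfps \<Rightarrow> ('a, 'b) mfps \<Rightarrow> ('a, 'b) mfps"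
  is "\<lambda>f g m. f m + g m" .
lift_definition minus_mfps :: "('a, 'b) mfps \<Rightarrow> ('a, 'b) mfps \<Rightarrow> ('a, 'b) mfps"
  is "\<lambda>f g m. f m - g m" .
lift_definition uminus_mfps :: "('a, 'b) mfps \<Rightarrow> ('a, 'b) mfps"
  is "\<lambda>f m. - f m" .
lift_definition times_mfps :: "('a, 'b) mfps \<Rightarrow> ('a, 'b) mfps \<Rightarrow> ('a, 'b) mfps"
  is "\<lambda>f g m. \<Sum>(a, b) \<in> {(a, b). a + b = m}. f a * g b" .

instance
proof
  fix a b c :: "('a, 'b) mfps"
  show "a + b + c = a + (b + c)" by transfer (simp add: add.assoc)
  show "a + b = b + a" by transfer (simp add: add.commute)
  show "0 + a = a" by transfer simp
  show "- a + a = 0" by transfer simp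
  show "a - b = a + - b" by transfer simp
  show "(0 :: ('a, 'b) mfps) \<noteq> 1" by transfer (metis zero_neq_one)
  show "(a + b) * c = a * c + b * c"
    by transfer (simp add: distrib_right sum.distrib case_prod_unfold)
  show "a * b = b * a"
  proof (transfer, rule ext)
    fix f g :: "'a multiset \<Rightarrow> 'b" and m
    show "(\<Sum>(a, b) \<in> {(a, b). a + b = m}. f a * g b) =
          (\<Sum>(a, b) \<in> {(a, b). a + b = m}. g a * f b)"
      by (rule sum.reindex_bij_witness[of _ prod.swap prod.swap])
        (auto simp: add.commute mult.commute)
  qed
  show "1 * a = a"
  proof (transfer, rule ext)
    fix f :: "'a multiset \<Rightarrow> 'b" and m
    have "(\<Sum>(a, b) \<in> {(a, b). a + b = m}. (if a = {#} then 1 else 0) * f b) =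
          (\<Sum>(a, b) \<in> {({#} :: 'a multiset, m)}. (if a = {#} then 1 else 0) * f b)"
      by (rule sum.mono_neutral_right[OF finite_mset_splits]) (auto split: if_splits)
    then show "(\<Sum>(a, b) \<in> {(a, b). a + b = m}. (if a = {#} then 1 else 0) * f b) = f m"
      by simp
  qed
  show "a * b * c = a * (b * c)"
  proof (transfer, rule ext)
    fix f g h :: "'a multiset \<Rightarrow> 'b" and m
    have "(\<Sum>(p, c) \<in> {(p, c). p + c = m}. (\<Sum>(a, b) \<in> {(a, b). a + b = p}. f a * g b) * h c) =
          (\<Sum>(x, y) \<in> (SIGMA x : {(p, c). p + c = m}. {(a, b). a + b = fst x}).
             f (fst y) * g (snd y) * h (snd x))"
      by (subst sum.Sigma[symmetric])
        (simp_all add: case_prod_unfold sum_distrib_right finite_mset_splits[unfolded case_prod_unfold])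
    also have "\<dots> =
          (\<Sum>(x, y) \<in> (SIGMA x : {(a, q). a + q = m}. {(b, c). b + c = snd x}).
             f (fst x) * (g (fst y) * h (snd y)))"
      by (rule sum.reindex_bij_witness[of _
            "\<lambda>(x, y). ((fst x + fst y, snd y), (fst x, fst y))"
            "\<lambda>(x, y). ((fst y, snd y + snd x), (snd y, snd x))"])
        (auto simp: add.assoc mult.assoc)
    also have "\<dots> =
          (\<Sum>(a, q) \<in> {(a, q). a + q = m}. f a * (\<Sum>(b, c) \<in> {(b, c). b + c = q}. g b * h c))"
      by (subst sum.Sigma[symmetric])
        (simp_all add: case_prod_unfold sum_distrib_left finite_mset_splits[unfolded case_prod_unfold])
    finally show "(\<Sum>(p, c) \<in> {(p, c). p + c = m}. (\<Sum>(a, b) \<in> {(a, b). a + b = p}. f a * g b) * h c) =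
      (\<Sum>(a, q) \<in> {(a, q). a + q = m}. f a * (\<Sum>(b, c) \<in> {(b, c). b + c = q}. g b * h c))" .
  qed
qed

end

text \<open>
  The inverse is the ring inverse on units and (by convention) \<open>0\<close> elsewhere. Its only
  purpose is to make the library's \<open>inverse\<close> and \<open>/\<close> available on (iterated) univariate
  power series over \<^typ>\<open>('v, 'a) mfps\<close>.
\<close>

instantiation mfps :: (type, comm_ring_1) inverse
begin

definition inverse_mfps :: "('a, 'b) mfps \<Rightarrow> ('a, 'b) mfps" where
  "inverse_mfps f = (if f dvd 1 then THE g. f * g = 1 else 0)"

definition divide_mfps :: "('a, 'b) mfps \<Rightarrow> ('a, 'b) mfps \<Rightarrow> ('a, 'b) mfps" where
  "divide_mfps f g = f * inverse g"

instance ..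

end

lemma mfps_inverse_unit:
  fixes f :: "('v, 'a :: comm_ring_1) mfps"
  assumes "f * g = 1"
  shows "inverse f = g"
proof -
  have "f dvd 1" using assms by (rule dvdI[OF sym])
  moreover have "(THE g. f * g = 1) = g"
  proof (rule the_equality)
    fix g' assume "f * g' = 1"
    have "g' = g' * (f * g)" using assms by simp
    also have "\<dots> = (f * g') * g" by (simp add: ac_simps)
    also have "\<dots> = g" using \<open>f * g' = 1\<close> by simp
    finally show "g' = g" .
  qed (fact assms)
  ultimately show ?thesis by (simp add: inverse_mfps_def)
qed

definition mvar :: "'v \<Rightarrow> ('v, 'a :: comm_ring_1) mfps" where
  "mvar v = Abs_mfps (\<lambda>m. if m = {#v#} then 1 else 0)"

text \<open>
  Formal (coefficientwise) sum of a possibly infinite family of power series; meaningful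
  when every monomial has a nonzero coefficient in only finitely many members. This holds
  in both uses below, since a monotone sequence is determined by its multiset of values.
\<close>

definition mfps_sum :: "('i \<Rightarrow> ('v, 'a :: comm_ring_1) mfps) \<Rightarrow> 'i set \<Rightarrow> ('v, 'a) mfps" where
  "mfps_sum f A = Abs_mfps (\<lambda>m. \<Sum>i \<in> {i \<in> A. mcoeff (f i) m \<noteq> 0}. mcoeff (f i) m)"


section \<open>Quasisymmetric and symmetric functions\<close>

text \<open>Power series over the integers in \<open>x\<^sub>1, x\<^sub>2, \<dots>\<close>; the index \<open>0\<close> is never used.\<close>

type_synonym xseries = "(nat, int) mfps"

definition fund_qsym :: "nat set \<Rightarrow> nat \<Rightarrow> xseries" where
  "fund_qsym S n = mfps_sum (\<lambda>i. \<Prod>j = 1..n. mvar (i j))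
     {i \<in> {1..n} \<rightarrow>\<^sub>E {1..}.
        (\<forall>j \<in> {1..<n}. i j \<ge> i (Suc j)) \<and> (\<forall>j \<in> S. i j > i (Suc j))}"

definition complete_sym :: "nat \<Rightarrow> xseries" where
  "complete_sym n = mfps_sum (\<lambda>i. \<Prod>j = 1..n. mvar (i j))
     {i \<in> {1..n} \<rightarrow>\<^sub>E {1..}. \<forall>j \<in> {1..<n}. i j \<le> i (Suc j)}"


section \<open>Permutation statistics\<close>

definition EXC :: "nat \<Rightarrow> (nat \<Rightarrow> nat) \<Rightarrow> nat set" where
  "EXC n \<sigma> = {i \<in> {1..<n}. \<sigma> i > i}"

definition exc :: "nat \<Rightarrow> (nat \<Rightarrow> nat) \<Rightarrow> nat" where
  "exc n \<sigma> = card (EXC n \<sigma>)"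

definition fixpts :: "nat \<Rightarrow> (nat \<Rightarrow> nat) \<Rightarrow> nat" where
  "fixpts n \<sigma> = card {i \<in> {1..n}. \<sigma> i = i}"

datatype letter = Barred nat | Plain nat

fun letter_less :: "letter \<Rightarrow> letter \<Rightarrow> bool" where
  "letter_less (Barred a) (Barred b) \<longleftrightarrow> a < b"
| "letter_less (Barred a) (Plain b) \<longleftrightarrow> True"
| "letter_less (Plain a) (Barred b) \<longleftrightarrow> False"
| "letter_less (Plain a) (Plain b) \<longleftrightarrow> a < b"

definition bar_word :: "nat \<Rightarrow> (nat \<Rightarrow> nat) \<Rightarrow> nat \<Rightarrow> letter" where
  "bar_word n \<sigma> i = (if i \<in> EXC n \<sigma> then Barred (\<sigma> i) else Plain (\<sigma> i))"

definition DEX :: "nat \<Rightarrow> (nat \<Rightarrow> nat) \<Rightarrow> nat set" where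
  "DEX n \<sigma> = {i \<in> {1..<n}. letter_less (bar_word n \<sigma> (Suc i)) (bar_word n \<sigma> i)}"

definition eulerian_qsym :: "nat \<Rightarrow> nat \<Rightarrow> nat \<Rightarrow> xseries" where
  "eulerian_qsym n j k =
     (if n = 0 then (if j = 0 \<and> k = 0 then 1 else 0)
      else \<Sum>\<sigma> \<in> {\<sigma>. \<sigma> permutes {1..n} \<and> exc n \<sigma> = j \<and> fixpts n \<sigma> = k}.
             fund_qsym (DEX n \<sigma>) n)"


section \<open>Power series in \<open>z\<close>, \<open>t\<close>, \<open>r\<close>\<close>

text \<open>
  The ring \<open>\<int>[[x]][[r]][[t]][[z]]\<close>: the outermost variable is \<open>z\<close>, the innermost \<open>r\<close>.
\<close>

type_synonym gseries = "xseries fps fps fps"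

definition var_z :: gseries where "var_z = fps_X"
definition var_t :: gseries where "var_t = fps_const fps_X"
definition var_r :: gseries where "var_r = fps_const (fps_const fps_X)"

definition H_gf :: gseries where
  "H_gf = Abs_fps (\<lambda>n. fps_const (fps_const (complete_sym n)))"

definition q_bracket :: "nat \<Rightarrow> 'a :: comm_ring_1 \<Rightarrow> 'a" where
  "q_bracket m t = (\<Sum>i<m. t ^ i)"

text \<open>
  The series \<open>\<Sum>n\<ge>2. t [n-1]\<^sub>t h\<^sub>n z\<^sup>n\<close>, given by its coefficients in \<open>z\<close>; inside the
  coefficient ring the variable \<open>t\<close> is \<^term>\<open>fps_X :: xseries fps fps\<close>.
\<close>

definition den_series :: gseries where
  "den_series = Abs_fps (\<lambda>n.
     if n \<ge> 2 then fps_X * q_bracket (n - 1) fps_X * fps_const (fps_const (complete_sym n))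
     else 0)"

text \<open>
  The library's \<open>/\<close> on power series is total. The lemmas \<open>denominator1\<close> and \<open>denominator2\<close>
  show that both denominators of the generating function identities are units and that
  \<open>/\<close> is genuine division by them.
\<close>

lemma inverse_one_mfps: "inverse (1 :: ('v, 'a :: comm_ring_1) mfps) = 1"
  by (rule mfps_inverse_unit) simp

lemma fps_inverse_unit:
  fixes f :: "'a :: {comm_ring_1, inverse} fps"
  assumes "fps_nth f 0 * inverse (fps_nth f 0) = 1"
  shows "f * inverse f = 1"
  unfolding fps_inverse_def by (rule fps_right_inverse) (fact assms)

lemma gseries_inverse_unit:
  fixes f :: gseries
  assumes "fps_nth (fps_nth (fps_nth f 0) 0) 0 = 1"
  shows "f * inverse f = 1" "g / f = g * inverse f"
proof -
  show "f * inverse f = 1"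
    by (intro fps_inverse_unit) (simp add: assms inverse_one_mfps)
  have "fps_nth f 0 \<noteq> 0" using assms by auto
  then have "subdegree f = 0" by simp
  then show "g / f = g * inverse f" by (rule fps_divide_unit')
qed

lemma denominator1:
  defines "d \<equiv> (H_gf oo (var_z * var_t)) - var_t * H_gf"
  shows "d * inverse d = 1" "g / d = g * inverse d"
proof -
  have "complete_sym 0 = mfps_sum (\<lambda>_. 1) {\<lambda>_ :: nat. undefined :: nat}"
    by (simp add: complete_sym_def)
  also have "\<dots> = 1"
  proof (rule mfps_eqI)
    fix m :: "nat multiset"
    have "{i \<in> {\<lambda>_. undefined :: nat}. mcoeff (1 :: xseries) m \<noteq> 0} =
          (if m = {#} then {\<lambda>_ :: nat. undefined :: nat} else {})"
      by (auto simp: one_mfps.rep_eq)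
    then show "mcoeff (mfps_sum (\<lambda>_. 1) {\<lambda>_ :: nat. undefined :: nat}) m = mcoeff (1 :: xseries) m"
      unfolding mfps_sum_def by (simp add: one_mfps.rep_eq)
  qed
  finally have "complete_sym 0 = 1" .
  then have "fps_nth (fps_nth (fps_nth d 0) 0) 0 = 1"
    by (simp add: d_def H_gf_def var_t_def)
  then show "d * inverse d = 1" "g / d = g * inverse d"
    by (rule gseries_inverse_unit)+
qed

lemma denominator2:
  shows "(1 - den_series) * inverse (1 - den_series) = 1"
    and "g / (1 - den_series) = g * inverse (1 - den_series)"
proof -
  have "fps_nth (fps_nth (fps_nth (1 - den_series) 0) 0) 0 = 1"
    by (simp add: den_series_def)
  then show "(1 - den_series) * inverse (1 - den_series) = 1"
    "g / (1 - den_series) = g * inverse (1 - den_series)"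
    by (rule gseries_inverse_unit)+
qed

end

theory Submission
  imports Defs "HOL-Library.Product_Lexorder"
begin

text \<open>
  Fix a monomial \<open>x\<^sup>m\<close> of degree \<open>n\<close> and let \<open>i\<^sub>1 \<ge> \<dots> \<ge> i\<^sub>n\<close> be its letters. The coefficient of \<open>x\<^sup>m\<close> in
  the fundamental quasisymmetric function of \<open>DEX \<sigma>\<close> is \<open>1\<close> if \<open>i\<close> drops strictly at every element
  of \<open>DEX \<sigma>\<close>, and \<open>0\<close> otherwise. So the coefficient of \<open>x\<^sup>m\<close> on the left-hand side is the sum of
  \<open>t^exc(\<sigma>) r^fix(\<sigma>)\<close> over the \<open>\<sigma>\<close> compatible with \<open>i\<close>. The positions \<open>v\<close> with \<open>i v = b\<close> form an
  interval, the block of \<open>b\<close>.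

  The compatible permutations are words in disguise. Let \<open>\<tau> = \<sigma>\<inverse>\<close> and record for every value \<open>v\<close>
  the letter \<open>c v = i (\<tau> v)\<close> and whether \<open>v\<close> is barred, that is \<open>\<tau> v < v\<close>. Compatibility says that
  \<open>\<sigma>\<close> lists the values by decreasing \<open>c\<close>, barred ones first, and then increasingly; hence \<open>\<tau> v\<close> is
  the rank of \<open>v\<close> in this order and the word determines \<open>\<sigma>\<close>. Counting ranks shows that the words
  that occur are given by conditions at each place (\<open>rank_less_iff_E\<close>): with \<open>b = i v\<close>, a barred \<open>v\<close>
  has \<open>c v \<ge> b\<close>, an unbarred one has \<open>c v \<le> b\<close>, and the first place of a block does not carry a barred
  \<open>b\<close>. The fixed points in the block of \<open>b\<close> are the longest run of unbarred letters \<open>b\<close> that ends the block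
  (\<open>rank_eq_iff_trailing\<close>). So the words are the terms of a product of linear forms in \<open>x\<close>
  (\<open>sum_compatible_eq_block_product\<close>).

  Splitting off the runs that end the blocks turns the sum over all \<open>m\<close> into
  \<open>D(t) \<cdot> H(r)\<close>, where \<open>D\<close> counts words without fixed points and \<open>H(\<rho>)\<close> is the sum of all monomials,
  weighted by \<open>\<rho>\<close> to the degree. It remains to prove \<open>D(t) (H(t) - t H(1)) = 1 - t\<close>. By the same
  splitting, the two products \<open>D(t) H(1)\<close> and \<open>D(t) H(t)\<close> count all words, with weight \<open>1\<close> or weight \<open>t\<close> for
  each fixed point. At \<open>x\<^sup>m\<close> they are coefficients of products over the letters \<open>b\<close> of \<open>m\<close>. Let \<open>A\<^sub>b\<close> be the
  linear form with weight \<open>t\<close> on the letters larger than \<open>b\<close>, \<open>1 + t\<close> on \<open>b\<close>, and \<open>1\<close> on the smaller ones.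
  A block of length \<open>p \<ge> 1\<close> contributes \<open>(A\<^sub>b - t x\<^sub>b) A\<^sub>b^(p-1)\<close> in the first case and
  \<open>(A\<^sub>b - x\<^sub>b) A\<^sub>b^(p-1)\<close> in the second. Keep only the letters of \<open>m\<close>, and let \<open>c\<close> be the next larger
  letter after \<open>b\<close>. Then \<open>A\<^sub>b - t x\<^sub>b\<close> and \<open>A\<^sub>c - x\<^sub>c\<close> are the same form, with weight \<open>t\<close> on the letters
  larger than \<open>b\<close> and \<open>1\<close> on the others. Only two forms remain unmatched: \<open>A\<^sub>b - t x\<^sub>b\<close> for the largest letter,
  which is the sum of all letters, and \<open>A\<^sub>b - x\<^sub>b\<close> for the smallest letter, which is \<open>t\<close> times that sum. So
  the second product is \<open>t\<close> times the first (\<open>mcoeff_prod_shift\<close>), which is the claim for \<open>m\<close> of positive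
  degree.

  Sorting by degree in \<open>z\<close> gives the identities: \<open>H(zt) - t H(z)\<close> has \<open>z\<^sup>n\<close>-coefficient
  \<open>(t\<^sup>n - t) h\<^sub>n\<close>, which is also that of \<open>(1 - t) (1 - \<Sum> t [n-1]\<^sub>t h\<^sub>n z\<^sup>n)\<close>.
\<close>

section \<open>Monomials, linear forms and truncation\<close>

definition mmonom :: "'a::comm_ring_1 \<Rightarrow> 'v multiset \<Rightarrow> ('v, 'a) mfps" where
  "mmonom c m = Abs_mfps (\<lambda>k. if k = m then c else 0)"

lemma mcoeff_mmonom: "mcoeff (mmonom c m) k = (if k = m then c else 0)"
  by (simp add: mmonom_def)

lemma mcoeff_add [simp]: "mcoeff (f + g) m = mcoeff f m + mcoeff g m"
  by (simp add: plus_mfps.rep_eq)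

lemma mcoeff_diff [simp]: "mcoeff (f - g) m = mcoeff f m - mcoeff g m"
  by (simp add: minus_mfps.rep_eq)

lemma mcoeff_0 [simp]: "mcoeff 0 m = 0"
  by (simp add: zero_mfps.rep_eq)

lemma mcoeff_1: "mcoeff 1 m = (if m = {#} then 1 else 0)"
  by (simp add: one_mfps.rep_eq)

lemma mcoeff_mult: "mcoeff (f * g) m = (\<Sum>(a, b) \<in> {(a, b). a + b = m}. mcoeff f a * mcoeff g b)"
  by (simp add: times_mfps.rep_eq)

lemma mcoeff_sum: "mcoeff (sum f A) m = (\<Sum>x\<in>A. mcoeff (f x) m)"
  by (induction A rule: infinite_finite_induct) simp_all

lemma mmonom_1: "mmonom 1 {#} = 1"
  by (rule mfps_eqI) (simp add: mcoeff_mmonom mcoeff_1)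

lemma mcoeff_mmonom_mult:
  "mcoeff (mmonom c a * P) m = (if a \<subseteq># m then c * mcoeff P (m - a) else 0)"
proof -
  have "mcoeff (mmonom c a * P) m =
      (\<Sum>(x, y) \<in> {(x, y). x + y = m} \<inter> {(a, m - a)}. mcoeff (mmonom c a) x * mcoeff P y)"
    unfolding mcoeff_mult
    by (rule sum.mono_neutral_right) (auto simp: mcoeff_mmonom split: if_splits)
  also have "\<dots> = (if a \<subseteq># m then c * mcoeff P (m - a) else 0)"
  proof (cases "a \<subseteq># m")
    case True
    then have "{(x, y). x + y = m} \<inter> {(a, m - a)} = {(a, m - a)}" by auto
    with True show ?thesis by (simp add: mcoeff_mmonom)
  next
    case False
    then have "a + (m - a) \<noteq> m" by (metis mset_subset_eq_add_left)
    then have "{(x, y). x + y = m} \<inter> {(a, m - a)} = {}" by auto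
    with False show ?thesis by simp
  qed
  finally show ?thesis .
qed

lemma mmonom_mult: "mmonom c a * mmonom d b = mmonom (c * d) (a + b)"
  by (rule mfps_eqI) (auto simp: mcoeff_mmonom_mult mcoeff_mmonom)

lemma mmonom_power: "mmonom c a ^ k = mmonom (c ^ k) (repeat_mset k a)"
  by (induction k) (simp_all add: mmonom_1 mmonom_mult)

lemma prod_mmonom:
  "finite J \<Longrightarrow> (\<Prod>j\<in>J. mmonom (c j) (a j)) = mmonom (\<Prod>j\<in>J. c j) (\<Sum>j\<in>J. a j)"
  by (induction J rule: finite_induct) (simp_all add: mmonom_1 mmonom_mult)

lemma sum_singletons: "finite J \<Longrightarrow> (\<Sum>j\<in>J. {#i j#}) = image_mset i (mset_set J)"
  by (induction J rule: finite_induct) simp_all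

text \<open>
  Whether two series agree up to the monomial \<open>m\<close> is compatible with multiplication. This is what
  reduces an infinite alphabet to the finitely many letters of \<open>m\<close>.
\<close>

definition agree_upto :: "'v multiset \<Rightarrow> ('v, 'a::comm_ring_1) mfps \<Rightarrow> ('v, 'a) mfps \<Rightarrow> bool" where
  "agree_upto m P Q \<longleftrightarrow> (\<forall>a. a \<subseteq># m \<longrightarrow> mcoeff P a = mcoeff Q a)"

lemma agree_upto_refl [simp]: "agree_upto m P P"
  by (simp add: agree_upto_def)

lemma agree_uptoD: "agree_upto m P Q \<Longrightarrow> mcoeff P m = mcoeff Q m"
  by (simp add: agree_upto_def)

lemma agree_upto_mult:
  assumes "agree_upto m P P'" "agree_upto m Q Q'"
  shows "agree_upto m (P * Q) (P' * Q')"
  unfolding agree_upto_def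
proof (intro allI impI)
  fix a assume a: "a \<subseteq># m"
  have "mcoeff P x = mcoeff P' x" "mcoeff Q y = mcoeff Q' y" if "x + y = a" for x y
  proof -
    have "x \<subseteq># m" "y \<subseteq># m"
      using a that by (auto intro: subset_mset.order_trans[OF mset_subset_eq_add_left]
               subset_mset.order_trans[OF mset_subset_eq_add_right])
    then show "mcoeff P x = mcoeff P' x" "mcoeff Q y = mcoeff Q' y"
      using assms by (auto simp: agree_upto_def)
  qed
  then show "mcoeff (P * Q) a = mcoeff (P' * Q') a"
    unfolding mcoeff_mult by (intro sum.cong) auto
qed

lemma agree_upto_prod:
  "(\<And>b. b \<in> B \<Longrightarrow> agree_upto m (P b) (Q b)) \<Longrightarrow> agree_upto m (prod P B) (prod Q B)"
  by (induction B rule: infinite_finite_induct) (simp_all add: agree_upto_mult)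

definition linear_form :: "('v \<Rightarrow> 'a::comm_ring_1) \<Rightarrow> ('v, 'a) mfps" where
  "linear_form \<alpha> = Abs_mfps (\<lambda>m. \<Sum>c\<in>set_mset m. if m = {#c#} then \<alpha> c else 0)"

lemma mcoeff_linear_form:
  "mcoeff (linear_form \<alpha>) m = (\<Sum>c\<in>set_mset m. if m = {#c#} then \<alpha> c else 0)"
  by (simp add: linear_form_def)

lemma linear_form_add: "linear_form \<alpha> + linear_form \<beta> = linear_form (\<lambda>c. \<alpha> c + \<beta> c)"
  by (rule mfps_eqI) (auto simp: mcoeff_linear_form simp flip: sum.distrib intro!: sum.cong)

lemma linear_form_single: "linear_form (\<lambda>c. if c = b then s else 0) = mmonom s {#b#}"
proof (rule mfps_eqI)
  fix m
  show "mcoeff (linear_form (\<lambda>c. if c = b then s else 0)) m = mcoeff (mmonom s {#b#}) m"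
  proof (cases "m = {#b#}")
    case False
    then show ?thesis by (auto simp: mcoeff_linear_form mcoeff_mmonom intro!: sum.neutral)
  qed (simp add: mcoeff_linear_form mcoeff_mmonom)
qed

lemma linear_form_agree_upto:
  "agree_upto m (linear_form \<alpha>) (\<Sum>c\<in>set_mset m. mmonom (\<alpha> c) {#c#})"
  unfolding agree_upto_def mcoeff_linear_form mcoeff_sum mcoeff_mmonom
  by (auto intro!: sum.mono_neutral_left dest: mset_subset_eqD)

text \<open>
  Multiplying out a product of linear forms indexed by positions lists the words \<open>c\<close>, with one
  letter per position.
\<close>

lemma mcoeff_prod_linear_form:
  assumes V: "finite V"
  shows "mcoeff (\<Prod>v\<in>V. linear_form (\<alpha> v)) m =
    (\<Sum>c | c \<in> V \<rightarrow>\<^sub>E set_mset m \<and> image_mset c (mset_set V) = m. \<Prod>v\<in>V. \<alpha> v (c v))"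
proof -
  have "mcoeff (\<Prod>v\<in>V. linear_form (\<alpha> v)) m =
      mcoeff (\<Prod>v\<in>V. \<Sum>c\<in>set_mset m. mmonom (\<alpha> v c) {#c#}) m"
    by (intro agree_uptoD agree_upto_prod linear_form_agree_upto)
  also have "(\<Prod>v\<in>V. \<Sum>c\<in>set_mset m. mmonom (\<alpha> v c) {#c#}) =
      (\<Sum>c\<in>V \<rightarrow>\<^sub>E set_mset m. \<Prod>v\<in>V. mmonom (\<alpha> v (c v)) {#c v#})"
    by (rule prod_sum_PiE) (use V in auto)
  also have "mcoeff \<dots> m = (\<Sum>c\<in>V \<rightarrow>\<^sub>E set_mset m.
      if image_mset c (mset_set V) = m then \<Prod>v\<in>V. \<alpha> v (c v) else 0)"
    unfolding mcoeff_sum prod_mmonom[OF V] sum_singletons[OF V] mcoeff_mmonom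
    by (auto intro!: sum.cong)
  also have "\<dots> =
    (\<Sum>c | c \<in> V \<rightarrow>\<^sub>E set_mset m \<and> image_mset c (mset_set V) = m. \<Prod>v\<in>V. \<alpha> v (c v))"
    using V by (subst sum.inter_filter[symmetric]) (auto intro!: finite_PiE sum.cong)
  finally show ?thesis .
qed

text \<open>Choosing a splitting of a monomial means splitting the power of each variable.\<close>

lemma sum_mset_splits:
  fixes \<phi> :: "'v \<Rightarrow> nat \<Rightarrow> nat \<Rightarrow> 'a::comm_semiring_1"
  shows "(\<Sum>(a, f) \<in> {(a, f). a + f = m}. \<Prod>b\<in>set_mset m. \<phi> b (count a b) (count f b)) =
    (\<Prod>b\<in>set_mset m. \<Sum>k\<le>count m b. \<phi> b (count m b - k) k)"
proof -
  define B where "B = set_mset m"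
  have B: "finite B" by (simp add: B_def)
  define F where "F g = (\<Sum>b\<in>B. replicate_mset (g b) b)" for g :: "'v \<Rightarrow> nat"
  have cF: "count (F g) b = (if b \<in> B then g b else 0)" for g b
    using B by (simp add: F_def count_sum)
  have "(\<Prod>b\<in>B. \<Sum>k\<le>count m b. \<phi> b (count m b - k) k) =
      (\<Sum>g\<in>Pi\<^sub>E B (\<lambda>b. {..count m b}). \<Prod>b\<in>B. \<phi> b (count m b - g b) (g b))"
    by (rule prod_sum_PiE) (auto simp: B)
  also have "\<dots> = (\<Sum>(a, f) \<in> {(a, f). a + f = m}. \<Prod>b\<in>B. \<phi> b (count a b) (count f b))"
  proof (rule sum.reindex_bij_witness[of _ "\<lambda>(a, f). restrict (count f) B" "\<lambda>g. (m - F g, F g)"])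
    fix g assume g: "g \<in> Pi\<^sub>E B (\<lambda>b. {..count m b})"
    have "F g \<subseteq># m" using g by (auto simp: subseteq_mset_def cF)
    then show "(m - F g, F g) \<in> {(a, f). a + f = m}" by simp
    show "(case (m - F g, F g) of (a, f) \<Rightarrow> restrict (count f) B) = g"
      using g by (auto simp: cF fun_eq_iff restrict_def PiE_def extensional_def)
    show "(case (m - F g, F g) of (a, f) \<Rightarrow> \<Prod>b\<in>B. \<phi> b (count a b) (count f b)) =
        (\<Prod>b\<in>B. \<phi> b (count m b - g b) (g b))"
      by (auto simp: cF intro!: prod.cong)
  next
    fix p assume p: "p \<in> {(a :: 'v multiset, f). a + f = m}"
    obtain a f where af: "p = (a, f)" by (cases p)
    have m: "m = a + f" using p af by simp
    have "F (restrict (count f) B) = f"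
      by (rule multiset_eqI) (auto simp: cF B_def m not_in_iff)
    then show "(m - F (case p of (a, f) \<Rightarrow> restrict (count f) B),
        F (case p of (a, f) \<Rightarrow> restrict (count f) B)) = p"
      by (simp add: af m)
    show "(case p of (a, f) \<Rightarrow> restrict (count f) B) \<in> Pi\<^sub>E B (\<lambda>b. {..count m b})"
      by (auto simp: af m)
  qed
  finally show ?thesis by (simp add: B_def)
qed

section \<open>The series of words and its functional equation\<close>

text \<open>
  The linear form of the letters admitted at a place of the block of \<open>b\<close>. A letter \<open>c > b\<close> is barred and
  weighs \<open>t\<close>, a letter \<open>c < b\<close> is unbarred, and \<open>b\<close> itself may come barred or unbarred as far as the two
  flags permit.
\<close>

definition cell :: "'a::comm_ring_1 \<Rightarrow> nat \<Rightarrow> bool \<Rightarrow> bool \<Rightarrow> (nat, 'a) mfps" where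
  "cell t b barred plain = linear_form (\<lambda>c.
     (if b < c \<or> b = c \<and> barred then t else 0) + (if c < b \<or> b = c \<and> plain then 1 else 0))"

lemma cell_barred: "cell t b True plain = cell t b False plain + mmonom t {#b#}"
  unfolding cell_def linear_form_add linear_form_single[symmetric]
  by (rule arg_cong[of _ _ linear_form]) auto

lemma cell_plain: "cell t b barred True = cell t b barred False + mmonom 1 {#b#}"
  unfolding cell_def linear_form_add linear_form_single[symmetric]
  by (rule arg_cong[of _ _ linear_form]) auto

text \<open>
  The words of length \<open>p\<close> for the block of \<open>b\<close> that contain no fixed point: the first place forbids a
  barred \<open>b\<close>, and the last one an unbarred \<open>b\<close>.
\<close>

definition fixfree_block :: "'a::comm_ring_1 \<Rightarrow> nat \<Rightarrow> nat \<Rightarrow> (nat, 'a) mfps" where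
  "fixfree_block t b p = (\<Prod>q<p. cell t b (q \<noteq> 0) (Suc q \<noteq> p))"

text \<open>
  All words for the block of \<open>b\<close>, sorted by the length \<open>k\<close> of the run of fixed points at the end; \<open>\<rho>\<close> is
  the weight of a fixed point.
\<close>

definition block :: "'a::comm_ring_1 \<Rightarrow> 'a \<Rightarrow> nat \<Rightarrow> nat \<Rightarrow> (nat, 'a) mfps" where
  "block t \<rho> b p = (\<Sum>k\<le>p. fixfree_block t b (p - k) * mmonom \<rho> {#b#} ^ k)"

lemma fixfree_block_0: "fixfree_block t b 0 = 1"
  and fixfree_block_1: "fixfree_block t b (Suc 0) = cell t b False False"
  by (simp_all add: fixfree_block_def)

lemma fixfree_block_Suc_Suc:
  "fixfree_block t b (Suc (Suc p)) = cell t b False True * cell t b True True ^ p * cell t b True False"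
proof -
  have "fixfree_block t b (Suc (Suc p)) = (\<Prod>q<Suc p. cell t b (q \<noteq> 0) True) * cell t b True False"
    by (simp add: fixfree_block_def)
  also have "(\<Prod>q<Suc p. cell t b (q \<noteq> 0) True) = cell t b False True * cell t b True True ^ p"
    by (subst prod.lessThan_Suc_shift) simp
  finally show ?thesis .
qed

lemma block_0: "block t \<rho> b 0 = 1"
  by (simp add: block_def fixfree_block_0)

lemma block_Suc: "block t \<rho> b (Suc p) = fixfree_block t b (Suc p) + mmonom \<rho> {#b#} * block t \<rho> b p"
  unfolding block_def by (subst sum.atMost_Suc_shift) (simp add: sum_distrib_left mult_ac)

text \<open>
  For \<open>\<rho> = 1\<close> and \<open>\<rho> = t\<close> the sum over the length of the final run collapses. With weight \<open>1\<close> a fixed point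
  fills the gap that the last place of a word without fixed points leaves. With weight \<open>t\<close> it plays the role
  of a barred \<open>b\<close> and fills the gap at the first place instead.
\<close>

lemma block_fixed_weight_1: "block t 1 b (Suc p) = cell t b False True * cell t b True True ^ p"
proof (induction p)
  case 0
  then show ?case
    by (simp add: block_Suc[of _ _ _ 0] block_0 fixfree_block_1 cell_plain[of t b False])
next
  case (Suc p)
  have "block t 1 b (Suc (Suc p)) = fixfree_block t b (Suc (Suc p)) + mmonom 1 {#b#} * block t 1 b (Suc p)"
    by (rule block_Suc)
  also have "\<dots> = cell t b False True * cell t b True True ^ p * (cell t b True False + mmonom 1 {#b#})"
    unfolding Suc.IH fixfree_block_Suc_Suc by (simp add: algebra_simps)
  finally show ?case by (simp add: cell_plain[of t b True] mult_ac)
qed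

lemma block_fixed_weight_t: "block t t b (Suc p) = cell t b True False * cell t b True True ^ p"
proof (induction p)
  case 0
  then show ?case
    by (simp add: block_Suc[of _ _ _ 0] block_0 fixfree_block_1 cell_barred[of t b False])
next
  case (Suc p)
  have "block t t b (Suc (Suc p)) = fixfree_block t b (Suc (Suc p)) + mmonom t {#b#} * block t t b (Suc p)"
    by (rule block_Suc)
  also have "\<dots> = (cell t b False True + mmonom t {#b#}) * cell t b True True ^ p * cell t b True False"
    unfolding Suc.IH fixfree_block_Suc_Suc by (simp add: algebra_simps)
  finally show ?case by (simp add: cell_barred[of t b True] mult_ac)
qed

text \<open>
  The set of elements strictly above one element is the set of elements weakly above the next one. So
  the factors of the product over the strict upper sets are shifted by one place against those of the product
  over the weak upper sets.
\<close>

lemma prod_upper_sets_telescope: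
  fixes y :: "'b::linorder set \<Rightarrow> 'a::comm_monoid_mult"
  assumes "finite C" "C \<noteq> {}"
  shows "(\<Prod>b\<in>C. y {c \<in> C. b \<le> c}) = y C * (\<Prod>b\<in>C - {Max C}. y {c \<in> C. b < c})"
proof -
  \<comment> \<open>\<open>N b\<close> is the predecessor of \<open>b\<close> in \<open>C\<close>.\<close>
  define N where "N b = Max {c \<in> C. c < b}" for b
  have fin: "finite {c \<in> C. P c}" for P using assms by simp
  have N: "N b \<in> C" "N b < b" "\<And>c. c \<in> C \<Longrightarrow> c < b \<Longrightarrow> c \<le> N b"
    if "b \<in> C" "b \<noteq> Min C" for b
  proof -
    have "Min C \<in> {c \<in> C. c < b}"
      using that assms by (auto simp: order_less_le)
    then have "N b \<in> {c \<in> C. c < b}" unfolding N_def by (intro Max_in fin) auto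
    then show "N b \<in> C" "N b < b" by auto
    show "c \<le> N b" if "c \<in> C" "c < b" for c
      unfolding N_def using that by (intro Max_ge fin) auto
  qed
  have bij: "bij_betw N (C - {Min C}) (C - {Max C})"
    unfolding bij_betw_def
  proof
    show "inj_on N (C - {Min C})"
    proof (rule linorder_inj_onI')
      fix a b assume "a \<in> C - {Min C}" "b \<in> C - {Min C}" "a < b"
      then show "N a \<noteq> N b" using N[of a] N[of b] by fastforce
    qed
    show "N ` (C - {Min C}) = C - {Max C}"
    proof (intro equalityI subsetI)
      fix d assume "d \<in> N ` (C - {Min C})"
      then obtain b where "b \<in> C" "b \<noteq> Min C" "d = N b" by auto
      moreover have "b \<le> Max C" using \<open>b \<in> C\<close> assms by simp
      ultimately show "d \<in> C - {Max C}" using N[of b] by fastforce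
    next
      fix d assume d: "d \<in> C - {Max C}"
      define b where "b = Min {c \<in> C. d < c}"
      have "Max C \<in> {c \<in> C. d < c}" using d assms by (auto simp: order_less_le)
      then have b: "b \<in> C" "d < b" unfolding b_def using Min_in[OF fin, of "\<lambda>c. d < c"] by auto
      have b_le: "b \<le> c" if "c \<in> C" "d < c" for c
        unfolding b_def using that by (intro Min_le fin) auto
      have "Min C \<le> d" using d assms by simp
      then have bm: "b \<noteq> Min C" using b by auto
      have "N b = d"
      proof (rule antisym)
        show "d \<le> N b" using N(3)[OF b(1) bm, of d] b d by simp
        show "N b \<le> d" using N(1,2)[OF b(1) bm] b_le[of "N b"] by (meson leD leI)
      qed
      then show "d \<in> N ` (C - {Min C})" using b bm by auto
    qed
  qed
  have "(\<Prod>b\<in>C. y {c \<in> C. b \<le> c}) = y {c \<in> C. Min C \<le> c} * (\<Prod>b\<in>C - {Min C}. y {c \<in> C. b \<le> c})"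
    using assms by (intro prod.remove) auto
  also have "{c \<in> C. Min C \<le> c} = C" using assms by auto
  also have "(\<Prod>b\<in>C - {Min C}. y {c \<in> C. b \<le> c}) = (\<Prod>b\<in>C - {Min C}. y {c \<in> C. N b < c})"
  proof (rule prod.cong[OF refl])
    fix b assume "b \<in> C - {Min C}"
    then have "{c \<in> C. b \<le> c} = {c \<in> C. N b < c}"
      using N[of b] by (auto simp: not_le[symmetric])
    then show "y {c \<in> C. b \<le> c} = y {c \<in> C. N b < c}" by simp
  qed
  also have "\<dots> = (\<Prod>b\<in>C - {Max C}. y {c \<in> C. b < c})"
    by (rule prod.reindex_bij_betw[OF bij])
  finally show ?thesis .
qed

text \<open>
  This is the heart of the proof. Up to the monomial \<open>m\<close>, both kinds of factors are values of one function
  \<open>y\<close>, where \<open>y D\<close> gives weight \<open>t\<close> to the letters in \<open>D\<close> and weight \<open>1\<close> to the other letters of \<open>m\<close>.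
  By telescoping the two products share all factors except one: \<open>y\<close> of the set of all letters on the
  left, and \<open>y {}\<close> on the right. Their ratio is \<open>t\<close>.
\<close>

lemma mcoeff_prod_shift:
  fixes t :: "'a::comm_ring_1"
  assumes "m \<noteq> {#}"
  shows "mcoeff (\<Prod>b\<in>set_mset m. cell t b True False * Z b) m =
    t * mcoeff (\<Prod>b\<in>set_mset m. cell t b False True * Z b) m"
proof -
  define C where "C = set_mset m"
  have C: "finite C" "C \<noteq> {}" using assms by (auto simp: C_def)
  define y where "y D = (\<Sum>c\<in>C. mmonom (if c \<in> D then t else 1) {#c#})" for D
  have le: "agree_upto m (cell t b True False) (y {c \<in> C. b \<le> c})" for b
  proof -
    have "y {c \<in> C. b \<le> c} = (\<Sum>c\<in>set_mset m. mmonom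
        ((if b < c \<or> b = c \<and> True then t else 0) + (if c < b \<or> b = c \<and> False then 1 else 0)) {#c#})"
      unfolding y_def C_def by (rule sum.cong) auto
    then show ?thesis unfolding cell_def by (simp only: linear_form_agree_upto)
  qed
  have less: "agree_upto m (cell t b False True) (y {c \<in> C. b < c})" for b
  proof -
    have "y {c \<in> C. b < c} = (\<Sum>c\<in>set_mset m. mmonom
        ((if b < c \<or> b = c \<and> False then t else 0) + (if c < b \<or> b = c \<and> True then 1 else 0)) {#c#})"
      unfolding y_def C_def by (rule sum.cong) auto
    then show ?thesis unfolding cell_def by (simp only: linear_form_agree_upto)
  qed
  have yC: "y C = mmonom t {#} * y {}"
    by (simp add: y_def sum_distrib_left mmonom_mult)
  have "mcoeff (\<Prod>b\<in>C. cell t b True False * Z b) m =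
      mcoeff (\<Prod>b\<in>C. y {c \<in> C. b \<le> c} * Z b) m"
    by (intro agree_uptoD agree_upto_prod agree_upto_mult le agree_upto_refl)
  also have "(\<Prod>b\<in>C. y {c \<in> C. b \<le> c} * Z b) =
      y C * (\<Prod>b\<in>C - {Max C}. y {c \<in> C. b < c}) * prod Z C"
    by (simp only: prod.distrib prod_upper_sets_telescope[OF C])
  also have "y C * (\<Prod>b\<in>C - {Max C}. y {c \<in> C. b < c}) =
      mmonom t {#} * (y {} * (\<Prod>b\<in>C - {Max C}. y {c \<in> C. b < c}))"
    by (simp add: yC mult_ac)
  also have "y {} * (\<Prod>b\<in>C - {Max C}. y {c \<in> C. b < c}) = (\<Prod>b\<in>C. y {c \<in> C. b < c})"
  proof -
    have empty: "{c \<in> C. Max C < c} = {}"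
      using C by (auto simp: not_less)
    have "(\<Prod>b\<in>C. y {c \<in> C. b < c}) =
        y {c \<in> C. Max C < c} * (\<Prod>b\<in>C - {Max C}. y {c \<in> C. b < c})"
      by (rule prod.remove) (use C in auto)
    then show ?thesis unfolding empty by (rule sym)
  qed
  also have "mcoeff (mmonom t {#} * (\<Prod>b\<in>C. y {c \<in> C. b < c}) * prod Z C) m =
      t * mcoeff (\<Prod>b\<in>C. y {c \<in> C. b < c} * Z b) m"
    by (simp add: mult.assoc mcoeff_mmonom_mult prod.distrib)
  also have "mcoeff (\<Prod>b\<in>C. y {c \<in> C. b < c} * Z b) m =
      mcoeff (\<Prod>b\<in>C. cell t b False True * Z b) m"
    by (intro agree_uptoD[symmetric] agree_upto_prod agree_upto_mult less agree_upto_refl)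
  finally show ?thesis by (simp add: C_def)
qed

definition all_monomials :: "'a::comm_ring_1 \<Rightarrow> (nat, 'a) mfps" where
  "all_monomials \<rho> = Abs_mfps (\<lambda>m. \<rho> ^ size m)"

text \<open>
  This is the generating function by excedances of the compatible permutations without fixed points.
  It is stated through blocks here, which is the form needed for its functional equation.
\<close>

definition derangement_series :: "'a::comm_ring_1 \<Rightarrow> (nat, 'a) mfps" where
  "derangement_series t = Abs_mfps (\<lambda>m. mcoeff (\<Prod>b\<in>set_mset m. fixfree_block t b (count m b)) m)"

text \<open>
  Multiplying by the series of all monomials appends, to each block, a run of fixed points of arbitrary
  length: the factor \<open>f\<close> of a splitting \<open>m = a + f\<close> says how many fixed points there are in each block.
\<close>

lemma mcoeff_derangement_times_all:
  "mcoeff (derangement_series t * all_monomials \<rho>) m =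
   mcoeff (\<Prod>b\<in>set_mset m. block t \<rho> b (count m b)) m"
proof -
  have "mcoeff (derangement_series t * all_monomials \<rho>) m =
     (\<Sum>(a, f) \<in> {(a, f). a + f = m}. mcoeff (\<Prod>b\<in>set_mset m.
        fixfree_block t b (count a b) * mmonom \<rho> {#b#} ^ count f b) m)"
    unfolding mcoeff_mult
  proof (rule sum.cong[OF refl])
    fix s assume "s \<in> {(a, f). a + f = m}"
    then obtain a f where s: "s = (a, f)" and m: "m = a + f" by auto
    have "(\<Prod>b\<in>set_mset m. mmonom \<rho> {#b#} ^ count f b) =
        (\<Prod>b\<in>set_mset m. mmonom (\<rho> ^ count f b) (replicate_mset (count f b) b))"
      by (simp add: mmonom_power repeat_mset_replicate_mset)
    also have "\<dots> = mmonom (\<Prod>b\<in>set_mset m. \<rho> ^ count f b)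
        (\<Sum>b\<in>set_mset m. replicate_mset (count f b) b)"
      by (rule prod_mmonom) simp
    also have "(\<Prod>b\<in>set_mset m. \<rho> ^ count f b) = \<rho> ^ size f"
    proof -
      have "size f = (\<Sum>b\<in>set_mset m. count f b)"
        unfolding size_multiset_overloaded_eq
        by (rule sum.mono_neutral_left) (auto simp: m not_in_iff)
      then show ?thesis by (simp add: power_sum)
    qed
    also have "(\<Sum>b\<in>set_mset m. replicate_mset (count f b) b) = f"
      by (rule multiset_eqI) (auto simp: count_sum m not_in_iff)
    finally have f: "(\<Prod>b\<in>set_mset m. mmonom \<rho> {#b#} ^ count f b) = mmonom (\<rho> ^ size f) f" .
    have "(\<Prod>b\<in>set_mset m. fixfree_block t b (count a b)) = (\<Prod>b\<in>set_mset a. fixfree_block t b (count a b))"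
      by (rule prod.mono_neutral_right) (auto simp: m not_in_iff fixfree_block_0)
    then have "mcoeff (\<Prod>b\<in>set_mset m. fixfree_block t b (count a b) * mmonom \<rho> {#b#} ^ count f b) m =
        mcoeff (mmonom (\<rho> ^ size f) f * (\<Prod>b\<in>set_mset a. fixfree_block t b (count a b))) m"
      by (simp add: prod.distrib f mult.commute)
    also have "\<dots> = mcoeff (derangement_series t) a * mcoeff (all_monomials \<rho>) f"
      by (simp add: mcoeff_mmonom_mult m derangement_series_def all_monomials_def mult.commute)
    finally show "(case s of (a, f) \<Rightarrow> mcoeff (derangement_series t) a * mcoeff (all_monomials \<rho>) f) =
        (case s of (a, f) \<Rightarrow> mcoeff (\<Prod>b\<in>set_mset m.
          fixfree_block t b (count a b) * mmonom \<rho> {#b#} ^ count f b) m)"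
      by (simp add: s)
  qed
  also have "\<dots> = mcoeff (\<Sum>(a, f) \<in> {(a, f). a + f = m}. \<Prod>b\<in>set_mset m.
        fixfree_block t b (count a b) * mmonom \<rho> {#b#} ^ count f b) m"
    by (simp add: mcoeff_sum case_prod_unfold)
  also have "(\<Sum>(a, f) \<in> {(a, f). a + f = m}. \<Prod>b\<in>set_mset m.
        fixfree_block t b (count a b) * mmonom \<rho> {#b#} ^ count f b) =
      (\<Prod>b\<in>set_mset m. block t \<rho> b (count m b))"
    unfolding block_def by (rule sum_mset_splits)
  finally show ?thesis .
qed

text \<open>
  Weighting fixed points by \<open>t\<close> instead of \<open>1\<close> multiplies the count by \<open>t\<close> in positive degree. On the
  permutations compatible with a given nonempty monomial, the weak excedance number is therefore
  distributed like the excedance number plus one.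
\<close>

lemma derangement_series_identity:
  "derangement_series t * (all_monomials t - mmonom t {#} * all_monomials 1) = mmonom (1 - t) {#}"
proof (rule mfps_eqI)
  fix m :: "nat multiset"
  let ?B = "\<lambda>\<rho>. mcoeff (\<Prod>b\<in>set_mset m. block t \<rho> b (count m b)) m"
  let ?Z = "\<lambda>b. cell t b True True ^ (count m b - 1)"
  have "mcoeff (derangement_series t * (all_monomials t - mmonom t {#} * all_monomials 1)) m =
      mcoeff (derangement_series t * all_monomials t) m -
      mcoeff (mmonom t {#} * (derangement_series t * all_monomials 1)) m"
    by (simp add: algebra_simps flip: mcoeff_diff)
  also have "\<dots> = ?B t - t * ?B 1"
    by (simp add: mcoeff_mmonom_mult mcoeff_derangement_times_all)
  also have "\<dots> = mcoeff (mmonom (1 - t) {#}) m"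
  proof (cases "m = {#}")
    case True
    then show ?thesis by (simp add: mcoeff_1 mcoeff_mmonom)
  next
    case False
    have t: "block t t b (count m b) = cell t b True False * ?Z b"
      and 1: "block t 1 b (count m b) = cell t b False True * ?Z b" if b: "b \<in># m" for b
    proof -
      obtain p where "count m b = Suc p"
        using b by (cases "count m b") (simp_all add: count_eq_zero_iff)
      then show "block t t b (count m b) = cell t b True False * ?Z b"
        "block t 1 b (count m b) = cell t b False True * ?Z b"
        by (simp_all add: block_fixed_weight_t block_fixed_weight_1)
    qed
    have "?B t = mcoeff (\<Prod>b\<in>set_mset m. cell t b True False * ?Z b) m"
      by (intro arg_cong2[of _ _ _ _ mcoeff] prod.cong refl t)
    also have "\<dots> = t * mcoeff (\<Prod>b\<in>set_mset m. cell t b False True * ?Z b) m"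
      by (rule mcoeff_prod_shift[OF False])
    also have "mcoeff (\<Prod>b\<in>set_mset m. cell t b False True * ?Z b) m = ?B 1"
      by (intro arg_cong2[of _ _ _ _ mcoeff] prod.cong refl 1[symmetric])
    finally show ?thesis using False by (simp add: mcoeff_mmonom)
  qed
  finally show "mcoeff (derangement_series t *
      (all_monomials t - mmonom t {#} * all_monomials 1)) m = mcoeff (mmonom (1 - t) {#}) m" .
qed

section \<open>Ranks with respect to a key\<close>

lemma initial_segment:
  fixes D :: "nat set"
  assumes "D \<subseteq> {1..n}" and "\<And>j k. k \<in> D \<Longrightarrow> 1 \<le> j \<Longrightarrow> j \<le> k \<Longrightarrow> j \<in> D"
  shows "D = {1..card D}"
proof (cases "D = {}")
  case False
  have fin: "finite D" using assms(1) finite_subset by blast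
  have "D = {1..Max D}"
  proof (intro equalityI subsetI)
    fix x assume "x \<in> D"
    then show "x \<in> {1..Max D}" using assms(1) fin by auto
  next
    fix x assume "x \<in> {1..Max D}"
    then show "x \<in> D" using assms(2)[OF Max_in[OF fin False]] by auto
  qed
  moreover from this have "card D = Max D" by (metis card_atLeastAtMost diff_Suc_1)
  ultimately show ?thesis by simp
qed simp

lemma card_image_mset_eq:
  assumes "finite V" "image_mset c (mset_set V) = image_mset d (mset_set V)"
  shows "card {v \<in> V. P (c v)} = card {v \<in> V. P (d v)}"
proof -
  have "card {v \<in> V. P (f v)} = size (filter_mset P (image_mset f (mset_set V)))" for f
    using assms(1) by (simp add: filter_mset_image_mset)
  then show ?thesis using assms(2) by simp
qed

locale keyed =
  fixes n :: nat and key :: "nat \<Rightarrow> 'k::linorder"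
  assumes inj_key: "inj_on key {1..n}"
begin

definition rank :: "nat \<Rightarrow> nat" where
  "rank v = (if v \<in> {1..n} then card {w \<in> {1..n}. key w \<le> key v} else v)"

lemma rank_less:
  assumes "w \<in> {1..n}" "v \<in> {1..n}" "key w < key v"
  shows "rank w < rank v"
proof -
  have "{u \<in> {1..n}. key u \<le> key w} \<subset> {u \<in> {1..n}. key u \<le> key v}"
  proof
    show "{u \<in> {1..n}. key u \<le> key w} \<subseteq> {u \<in> {1..n}. key u \<le> key v}"
      using assms by auto
    have "v \<in> {u \<in> {1..n}. key u \<le> key v}" "v \<notin> {u \<in> {1..n}. key u \<le> key w}"
      using assms by auto
    then show "{u \<in> {1..n}. key u \<le> key w} \<noteq> {u \<in> {1..n}. key u \<le> key v}"
      by blast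
  qed
  then show ?thesis using assms by (simp add: rank_def psubset_card_mono)
qed

lemma rank_less_iff:
  assumes "w \<in> {1..n}" "v \<in> {1..n}"
  shows "rank w < rank v \<longleftrightarrow> key w < key v"
proof (cases "key w" "key v" rule: linorder_cases)
  case equal
  then have "w = v" using inj_key assms by (auto dest: inj_onD)
  then show ?thesis by simp
qed (use assms rank_less[of w v] rank_less[of v w] in auto)

lemma rank_permutes: "rank permutes {1..n}"
proof (rule inj_imp_permutes)
  show "inj_on rank {1..n}"
  proof (rule linorder_inj_onI')
    fix a b assume ab: "a \<in> {1..n}" "b \<in> {1..n}" "a < b"
    then have "key a \<noteq> key b" using inj_key by (auto dest: inj_onD)
    then show "rank a \<noteq> rank b"
      using ab rank_less[of a b] rank_less[of b a] by (cases "key a" "key b" rule: linorder_cases) auto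
  qed
  fix v assume v: "v \<in> {1..n}"
  then have "0 < card {w \<in> {1..n}. key w \<le> key v}" by (auto simp: card_gt_0_iff)
  moreover have "card {w \<in> {1..n}. key w \<le> key v} \<le> card {1..n}" by (rule card_mono) auto
  ultimately show "rank v \<in> {1..n}" using v by (simp add: rank_def)
qed (auto simp: rank_def)

text \<open>
  A permutation value \<open>\<tau> v\<close> is the number of \<open>w\<close> with \<open>\<tau> w \<le> \<tau> v\<close>, and these are the \<open>w\<close> whose key is at most
  that of \<open>v\<close>.
\<close>

lemma permutation_eq_rank:
  assumes \<tau>: "\<tau> permutes {1..n}"
    and mono: "\<And>w v. w \<in> {1..n} \<Longrightarrow> v \<in> {1..n} \<Longrightarrow> \<tau> w < \<tau> v \<Longrightarrow> key w < key v"
  shows "\<tau> = rank"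
proof
  fix v
  show "\<tau> v = rank v"
  proof (cases "v \<in> {1..n}")
    case True
    have "{w \<in> {1..n}. key w \<le> key v} = {w \<in> {1..n}. \<tau> w \<le> \<tau> v}"
    proof (intro Collect_cong conj_cong refl)
      fix w assume w: "w \<in> {1..n}"
      show "key w \<le> key v \<longleftrightarrow> \<tau> w \<le> \<tau> v"
      proof (cases "\<tau> w" "\<tau> v" rule: linorder_cases)
        case less
        then show ?thesis using mono[OF w True] by simp
      next
        case equal
        then have "w = v" using permutes_inj[OF \<tau>] by (simp add: inj_eq)
        then show ?thesis by simp
      next
        case greater
        then show ?thesis using mono[OF True w] by simp
      qed
    qed
    moreover have "\<tau> ` {w \<in> {1..n}. \<tau> w \<le> \<tau> v} = {1..\<tau> v}"
    proof (intro equalityI subsetI)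
      fix x assume x: "x \<in> {1..\<tau> v}"
      have "\<tau> v \<le> n" using True permutes_in_image[OF \<tau>, of v] by simp
      then have "inv \<tau> x \<in> {1..n}" "\<tau> (inv \<tau> x) = x"
        using x permutes_in_image[OF permutes_inv[OF \<tau>], of x] permutes_inverses[OF \<tau>] by auto
      then show "x \<in> \<tau> ` {w \<in> {1..n}. \<tau> w \<le> \<tau> v}" using x by force
    next
      fix x assume "x \<in> \<tau> ` {w \<in> {1..n}. \<tau> w \<le> \<tau> v}"
      then show "x \<in> {1..\<tau> v}" using permutes_in_image[OF \<tau>] by fastforce
    qed
    moreover have "card (\<tau> ` {w \<in> {1..n}. \<tau> w \<le> \<tau> v}) = card {w \<in> {1..n}. \<tau> w \<le> \<tau> v}"
      using permutes_inj[OF \<tau>] by (intro card_image) (auto intro: inj_on_subset)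
    ultimately show ?thesis using True by (simp add: rank_def)
  next
    case False
    then show ?thesis unfolding rank_def if_not_P[OF False] by (rule permutes_not_in[OF \<tau>])
  qed
qed

end

section \<open>Compatible permutations as words\<close>

text \<open>
  Lexicographic order on the key means: larger letters first, then barred places (\<open>False < True\<close>),
  then the smaller value.
\<close>

definition code_key :: "(nat \<Rightarrow> nat) \<Rightarrow> nat set \<Rightarrow> nat \<Rightarrow> int \<times> bool \<times> nat" where
  "code_key c E v = (- int (c v), v \<notin> E, v)"

lemma code_key_le: "code_key c E w \<le> code_key c E v \<longleftrightarrow>
    c v < c w \<or> c v = c w \<and> (w \<in> E \<and> v \<notin> E \<or> (w \<in> E \<longleftrightarrow> v \<in> E) \<and> w \<le> v)"
  by (auto simp: code_key_def)

interpretation code: keyed n "code_key c E" for n c E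
  by unfold_locales (auto simp: code_key_def inj_on_def)

text \<open>
  The decreasing arrangement \<open>i\<close> of a monomial \<open>m\<close>. The block of \<open>b\<close> is the interval of the positions carrying
  \<open>b\<close>; the block starts after the positions with larger letters, whose number is \<open>block_start b\<close>.
\<close>

locale arrangement =
  fixes m :: "nat multiset" and n :: nat and i :: "nat \<Rightarrow> nat"
  assumes content: "image_mset i (mset_set {1..n}) = m"
    and decr: "1 \<le> j \<Longrightarrow> j \<le> k \<Longrightarrow> k \<le> n \<Longrightarrow> i k \<le> i j"
begin

definition block_start :: "nat \<Rightarrow> nat" where
  "block_start b = card {v \<in> {1..n}. b < i v}"

lemma card_letter:
  assumes "image_mset c (mset_set {1..n}) = m"
  shows "card {v \<in> {1..n}. b < c v} = block_start b"
    and "card {v \<in> {1..n}. c v = b} = count m b"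
    and "card {v \<in> {1..n}. b \<le> c v} = block_start b + count m b"
proof -
  show gt: "card {v \<in> {1..n}. b < c v} = block_start b"
    using card_image_mset_eq[of "{1..n}" c i "\<lambda>x. b < x"] assms content
    by (simp add: block_start_def)
  show eq: "card {v \<in> {1..n}. c v = b} = count m b"
  proof -
    have "card {v \<in> {1..n}. c v = b} = size (filter_mset (\<lambda>x. x = b) (image_mset c (mset_set {1..n})))"
      by (simp add: filter_mset_image_mset)
    then show ?thesis unfolding assms filter_eq_replicate_mset by simp
  qed
  have "{v \<in> {1..n}. b \<le> c v} = {v \<in> {1..n}. b < c v} \<union> {v \<in> {1..n}. c v = b}" by auto
  then show "card {v \<in> {1..n}. b \<le> c v} = block_start b + count m b"
    by (simp add: card_Un_disjoint disjoint_iff flip: gt eq)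
qed

lemma less_iff_le_start:
  assumes "v \<in> {1..n}"
  shows "b < i v \<longleftrightarrow> v \<le> block_start b"
proof -
  have "{v \<in> {1..n}. b < i v} = {1..block_start b}"
    unfolding block_start_def
  proof (rule initial_segment)
    show "{v \<in> {1..n}. b < i v} \<subseteq> {1..n}" by auto
    fix j k assume "k \<in> {v \<in> {1..n}. b < i v}" "1 \<le> j" "j \<le> k"
    then show "j \<in> {v \<in> {1..n}. b < i v}" using decr[of j k] by simp
  qed
  then have "v \<in> {v \<in> {1..n}. b < i v} \<longleftrightarrow> v \<in> {1..block_start b}" by (simp only:)
  then show ?thesis using assms by simp
qed

lemma le_iff_le_start:
  assumes "v \<in> {1..n}"
  shows "b \<le> i v \<longleftrightarrow> v \<le> block_start b + count m b"
proof -
  have "{v \<in> {1..n}. b \<le> i v} = {1..card {v \<in> {1..n}. b \<le> i v}}"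
  proof (rule initial_segment)
    show "{v \<in> {1..n}. b \<le> i v} \<subseteq> {1..n}" by auto
    fix j k assume "k \<in> {v \<in> {1..n}. b \<le> i v}" "1 \<le> j" "j \<le> k"
    then show "j \<in> {v \<in> {1..n}. b \<le> i v}" using decr[of j k] by simp
  qed
  then have "v \<in> {v \<in> {1..n}. b \<le> i v} \<longleftrightarrow> v \<in> {1..block_start b + count m b}"
    by (simp only: card_letter(3)[OF content])
  then show ?thesis using assms by simp
qed

lemma eq_iff_block:
  assumes "v \<in> {1..n}"
  shows "i v = b \<longleftrightarrow> block_start b < v \<and> v \<le> block_start b + count m b"
  using less_iff_le_start[OF assms, of b] le_iff_le_start[OF assms, of b] by linarith

lemma block_end_le: "block_start b + count m b \<le> n"
proof -
  have "card {v \<in> {1..n}. b \<le> i v} \<le> card {1..n}" by (rule card_mono) auto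
  then show ?thesis unfolding card_letter(3)[OF content] by simp
qed

text \<open>
  A code is a word \<open>c\<close> with the content of \<open>m\<close> and a set \<open>E\<close> of barred places. The conditions are those
  satisfied by the code \<open>c v = i (\<tau> v)\<close>, \<open>E = {v. \<tau> v < v}\<close> of a permutation: \<open>\<tau> v < v\<close> forces
  \<open>i v \<le> i (\<tau> v)\<close>, and equality cannot happen at the first place of a block since \<open>\<tau> v\<close> would be an
  earlier place of the same block.
\<close>

definition codes :: "((nat \<Rightarrow> nat) \<times> nat set) set" where
  "codes = {(c, E). c \<in> {1..n} \<rightarrow>\<^sub>E set_mset m \<and> image_mset c (mset_set {1..n}) = m \<and> E \<subseteq> {1..n} \<and>
     (\<forall>v\<in>{1..n}. if v \<in> E then i v < c v \<or> i v = c v \<and> v \<noteq> Suc (block_start (i v)) else c v \<le> i v)}"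

text \<open>
  These places turn out to be the fixed points, see \<open>rank_eq_iff_trailing\<close>.
\<close>

definition trailing :: "(nat \<Rightarrow> nat) \<Rightarrow> nat set \<Rightarrow> nat \<Rightarrow> bool" where
  "trailing c E v \<longleftrightarrow> (\<forall>w\<in>{1..n}. v \<le> w \<and> i w = i v \<longrightarrow> c w = i v \<and> w \<notin> E)"

abbreviation rk :: "(nat \<Rightarrow> nat) \<Rightarrow> nat set \<Rightarrow> nat \<Rightarrow> nat" where
  "rk c E \<equiv> keyed.rank n (code_key c E)"

context
  fixes c E assumes cE: "(c, E) \<in> codes"
begin

lemma cE_content: "image_mset c (mset_set {1..n}) = m"
  using cE unfolding codes_def by blast

lemma cE_rules:
  assumes "v \<in> {1..n}"
  shows "v \<in> E \<Longrightarrow> i v \<le> c v" "v \<in> E \<Longrightarrow> i v = c v \<Longrightarrow> v \<noteq> Suc (block_start (c v))"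
    "v \<notin> E \<Longrightarrow> c v \<le> i v"
proof -
  have "if v \<in> E then i v < c v \<or> i v = c v \<and> v \<noteq> Suc (block_start (i v)) else c v \<le> i v"
    using cE assms unfolding codes_def by blast
  then show "v \<in> E \<Longrightarrow> i v \<le> c v"
    "v \<in> E \<Longrightarrow> i v = c v \<Longrightarrow> v \<noteq> Suc (block_start (c v))" "v \<notin> E \<Longrightarrow> c v \<le> i v"
    by (auto split: if_splits)
qed

lemma E_sub: "E \<subseteq> {1..n}"
  using cE unfolding codes_def by blast

lemma rk_eq: "v \<in> {1..n} \<Longrightarrow> rk c E v = card {w \<in> {1..n}. code_key c E w \<le> code_key c E v}"
  by (simp add: code.rank_def)

text \<open>
  Places are ranked by letter first, so the ranks of the places with letter \<open>b\<close> fill the block of \<open>b\<close>.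
  Hence the letter at a place can be read off from its rank.
\<close>

lemma rank_bounds:
  assumes v: "v \<in> {1..n}"
  shows "block_start (c v) < rk c E v" "rk c E v \<le> block_start (c v) + count m (c v)"
proof -
  have "card (insert v {w \<in> {1..n}. c v < c w}) \<le> rk c E v"
    unfolding rk_eq[OF v] using v by (intro card_mono) (auto simp: code_key_le)
  also have "card (insert v {w \<in> {1..n}. c v < c w}) = Suc (card {w \<in> {1..n}. c v < c w})"
    by simp
  finally show "block_start (c v) < rk c E v"
    unfolding card_letter(1)[OF cE_content] by simp
  have "rk c E v \<le> card {w \<in> {1..n}. c v \<le> c w}"
    unfolding rk_eq[OF v] by (intro card_mono) (auto simp: code_key_le)
  then show "rk c E v \<le> block_start (c v) + count m (c v)"
    unfolding card_letter(3)[OF cE_content] .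
qed

lemma rk_in: "v \<in> {1..n} \<Longrightarrow> rk c E v \<in> {1..n}"
  using permutes_in_image[OF code.rank_permutes] by blast

lemma i_rank: "v \<in> {1..n} \<Longrightarrow> i (rk c E v) = c v"
  by (rule eq_iff_block[OF rk_in, THEN iffD2]) (simp_all only: rank_bounds simp_thms)

text \<open>
  Unbarred places with letter \<open>b\<close> never lie beyond the block of \<open>b\<close>. This bounds the number of places that
  follow \<open>v\<close> in the order of keys within the same letter.
\<close>

lemma later_plain_subset:
  "{w \<in> {1..n}. v < w \<and> c w = b \<and> w \<notin> E} \<subseteq> {v<..block_start b + count m b}"
proof clarify
  fix w assume w: "w \<in> {1..n}" "v < w" "w \<notin> E" "b = c w"
  then show "w \<in> {v<..block_start (c w) + count m (c w)}"
    using cE_rules(3)[OF w(1,3)] le_iff_le_start[OF w(1), of "c w"] by simp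
qed

text \<open>
  The code of the permutation \<open>rk c E\<close> has the prescribed barred places. If \<open>c v \<noteq> i v\<close> then \<open>v\<close> is already
  separated from its rank by blocks. If \<open>c v = i v = b\<close>, all happens within one block. For \<open>v\<close> barred, the places
  with letter \<open>b\<close> ranked no later than \<open>v\<close> are barred and at most \<open>v\<close>, so they lie in the block, but not at its
  first place; there are too few of them for the rank to reach \<open>v\<close>. For \<open>v\<close> unbarred, the places with letter \<open>b\<close> ranked after
  \<open>v\<close> lie in the block after \<open>v\<close>, so there are too few for the rank to drop below \<open>v\<close>.
\<close>

lemma rank_less_iff_E:
  assumes v: "v \<in> {1..n}"
  shows "rk c E v < v \<longleftrightarrow> v \<in> E"
proof
  assume vE: "v \<in> E"
  show "rk c E v < v"
  proof (cases "i v = c v")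
    case False
    then have "i v < c v" using cE_rules(1)[OF v vE] by simp
    then show ?thesis using rank_bounds(2)[OF v] le_iff_le_start[OF v, of "c v"] by linarith
  next
    case True
    let ?a = "block_start (c v)"
    have "{w \<in> {1..n}. code_key c E w \<le> code_key c E v} \<subseteq>
        {w \<in> {1..n}. c v < c w} \<union> {Suc (Suc ?a)..v}"
    proof
      fix w assume w: "w \<in> {w \<in> {1..n}. code_key c E w \<le> code_key c E v}"
      show "w \<in> {w \<in> {1..n}. c v < c w} \<union> {Suc (Suc ?a)..v}"
      proof (cases "c v < c w")
        case False
        then have wE: "c w = c v" "w \<in> E" "w \<le> v" and wn: "w \<in> {1..n}"
          using w vE by (auto simp: code_key_le)
        have "\<not> w \<le> ?a"
          using cE_rules(1)[OF wn wE(2)] less_iff_le_start[OF wn, of "c v"] wE(1) by simp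
        moreover have "w \<noteq> Suc ?a"
        proof
          assume "w = Suc ?a"
          moreover have "i v \<le> i w" using decr[of w v] wn v wE by simp
          ultimately show False
            using cE_rules(1,2)[OF wn wE(2)] wE(1) True by simp
        qed
        ultimately show ?thesis using wE by simp
      qed (use w in simp)
    qed
    then have "rk c E v \<le> card ({w \<in> {1..n}. c v < c w} \<union> {Suc (Suc ?a)..v})"
      unfolding rk_eq[OF v] by (intro card_mono) auto
    also have "\<dots> \<le> ?a + card {Suc (Suc ?a)..v}"
      unfolding card_letter(1)[OF cE_content, symmetric] by (rule card_Un_le)
    also have "\<dots> < v" using True eq_iff_block[OF v, of "c v"] cE_rules(2)[OF v vE] by auto
    finally show ?thesis .
  qed
next
  show "v \<in> E" if less: "rk c E v < v"
  proof (rule ccontr)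
    assume vE: "v \<notin> E"
    show False
    proof (cases "i v = c v")
      case False
      then have "c v < i v" using cE_rules(3)[OF v vE] by simp
      then show False using less rank_bounds(1)[OF v] less_iff_le_start[OF v, of "c v"] by linarith
    next
      case True
      let ?s = "block_start (c v) + count m (c v)"
      let ?S = "{w \<in> {1..n}. v < w \<and> c w = c v \<and> w \<notin> E}"
      have "{w \<in> {1..n}. c v \<le> c w} = {w \<in> {1..n}. code_key c E w \<le> code_key c E v} \<union> ?S"
        using vE by (auto simp: code_key_le)
      then have "?s \<le> rk c E v + card ?S"
        unfolding rk_eq[OF v] card_letter(3)[OF cE_content, symmetric] by (simp only: card_Un_le)
      moreover have "?S \<subseteq> {v<..?s}" by (rule later_plain_subset)
      then have "card ?S \<le> ?s - v" using card_mono[of "{v<..?s}" ?S] by simp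
      moreover have "v \<le> ?s" using True eq_iff_block[OF v, of "c v"] by simp
      ultimately show False using less by linarith
    qed
  qed
qed

text \<open>
  In the count for an unbarred \<open>v\<close> with \<open>c v = i v\<close>, the rank equals \<open>v\<close> exactly if every place after \<open>v\<close> in its
  block is ranked after \<open>v\<close> within the same letter, that is, unbarred with that letter.
\<close>

lemma rank_eq_iff_trailing:
  assumes v: "v \<in> {1..n}"
  shows "rk c E v = v \<longleftrightarrow> trailing c E v"
proof (cases "v \<notin> E \<and> i v = c v")
  case False
  have "rk c E v \<noteq> v"
  proof (cases "v \<in> E")
    case True
    then show ?thesis using rank_less_iff_E[OF v] by simp
  next
    case vE: False
    with False have "c v < i v" using cE_rules(3)[OF v vE] by simp
    then show ?thesis using rank_bounds(1)[OF v] less_iff_le_start[OF v, of "c v"] by linarith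
  qed
  moreover have "\<not> trailing c E v" using False v by (auto simp: trailing_def)
  ultimately show ?thesis by simp
next
  case True
  let ?s = "block_start (c v) + count m (c v)"
  let ?S = "{w \<in> {1..n}. v < w \<and> c w = c v \<and> w \<notin> E}"
  let ?R = "{w \<in> {1..n}. code_key c E w \<le> code_key c E v}"
  have un: "{w \<in> {1..n}. c v \<le> c w} = ?R \<union> ?S"
    using True by (auto simp: code_key_le)
  have "u \<notin> ?R" if "u \<in> ?S" for u
    using that True by (simp add: code_key_le)
  then have "?R \<inter> ?S = {}" by blast
  then have "card (?R \<union> ?S) = card ?R + card ?S"
    by (intro card_Un_disjoint) simp_all
  then have s: "?s = rk c E v + card ?S"
    by (simp only: rk_eq[OF v] card_letter(3)[OF cE_content, symmetric] un)
  have sub: "?S \<subseteq> {v<..?s}" by (rule later_plain_subset)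
  have vs: "block_start (c v) < v" "v \<le> ?s" using True eq_iff_block[OF v, of "c v"] by simp_all
  have "rk c E v = v \<longleftrightarrow> card ?S = card {v<..?s}" using s vs by (simp only: card_greaterThanAtMost) linarith
  also have "\<dots> \<longleftrightarrow> ?S = {v<..?s}"
    by (rule iffI[OF card_subset_eq[OF finite_greaterThanAtMost sub] arg_cong[of _ _ card]])
  also have "\<dots> \<longleftrightarrow> trailing c E v"
  proof -
    have block: "i w = i v \<longleftrightarrow> w \<le> ?s" if "w \<in> {1..n}" "v \<le> w" for w
      using that True vs eq_iff_block[of w "c v"] by simp
    have "?S = {v<..?s} \<longleftrightarrow> (\<forall>w. w \<in> {v<..?s} \<longrightarrow> w \<in> ?S)" using sub by blast
    also have "\<dots> \<longleftrightarrow> (\<forall>w\<in>{1..n}. v \<le> w \<and> i w = i v \<longrightarrow> c w = i v \<and> w \<notin> E)"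
    proof (intro iffI allI ballI impI)
      fix w assume all: "\<forall>w. w \<in> {v<..?s} \<longrightarrow> w \<in> ?S" and w: "w \<in> {1..n}" "v \<le> w \<and> i w = i v"
      show "c w = i v \<and> w \<notin> E"
      proof (cases "w = v")
        case False
        then have "w \<in> {v<..?s}" using w block[of w] by simp
        then have "w \<in> ?S" using all by blast
        then show ?thesis using True by simp
      qed (use True in simp)
    next
      fix w assume all: "\<forall>w\<in>{1..n}. v \<le> w \<and> i w = i v \<longrightarrow> c w = i v \<and> w \<notin> E"
        and w: "w \<in> {v<..?s}"
      then have wn: "w \<in> {1..n}" using v block_end_le[of "c v"] by simp
      then have "v \<le> w \<and> i w = i v" using block[OF wn] w by simp
      then have "c w = i v \<and> w \<notin> E" using bspec[OF all wn] by blast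
      then show "w \<in> ?S" using wn w True by simp
    qed
    also have "\<dots> \<longleftrightarrow> trailing c E v" by (simp only: trailing_def)
    finally show ?thesis .
  qed
  finally show ?thesis .
qed

end

end

lemma final_segment:
  fixes D :: "nat set"
  assumes "D \<subseteq> {a<..s}" and up: "\<And>j k. k \<in> D \<Longrightarrow> k \<le> j \<Longrightarrow> j \<le> s \<Longrightarrow> j \<in> D"
  shows "D = {s - card D<..s}"
proof (cases "D = {}")
  case False
  have fin: "finite D" using assms(1) finite_subset by blast
  define M where "M = Min D"
  have M: "M \<in> D" "\<And>x. x \<in> D \<Longrightarrow> M \<le> x" using fin False by (auto simp: M_def)
  have D: "D = {M..s}"
  proof (intro equalityI subsetI)
    fix x assume "x \<in> D"
    then show "x \<in> {M..s}" using assms(1) M(2) by auto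
  next
    fix x assume "x \<in> {M..s}"
    then show "x \<in> D" using up[OF M(1)] by auto
  qed
  have "0 < M" "M \<le> s" using M(1) assms(1) by auto
  then show ?thesis by (auto simp: D)
qed simp

context arrangement
begin

definition code_of :: "(nat \<Rightarrow> nat) \<Rightarrow> (nat \<Rightarrow> nat) \<times> nat set" where
  "code_of \<tau> = (restrict (i \<circ> \<tau>) {1..n}, {v \<in> {1..n}. \<tau> v < v})"

text \<open>
  The condition that makes \<open>\<tau>\<close> the rank function of its own code. For \<open>\<tau> = \<sigma>\<inverse>\<close> it says that \<open>i\<close> drops at every
  element of \<open>DEX \<sigma>\<close> (see \<open>compatible_inv_iff\<close>).
\<close>

definition compatible :: "(nat \<Rightarrow> nat) \<Rightarrow> bool" where
  "compatible \<tau> \<longleftrightarrow> \<tau> permutes {1..n} \<and> (\<forall>w\<in>{1..n}. \<forall>v\<in>{1..n}. \<tau> w < \<tau> v \<longrightarrow>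
     case_prod code_key (code_of \<tau>) w < case_prod code_key (code_of \<tau>) v)"

lemma i_in: "v \<in> {1..n} \<Longrightarrow> i v \<in> set_mset m"
  by (simp flip: content)

lemma code_of_in_codes:
  assumes \<tau>: "\<tau> permutes {1..n}"
  shows "code_of \<tau> \<in> codes"
proof -
  have in_n: "\<tau> v \<in> {1..n}" if "v \<in> {1..n}" for v
    using permutes_in_image[OF \<tau>] that by blast
  have "image_mset (restrict (i \<circ> \<tau>) {1..n}) (mset_set {1..n}) = image_mset (i \<circ> \<tau>) (mset_set {1..n})"
    by (rule image_mset_cong) simp
  also have "\<dots> = image_mset i (mset_set (\<tau> ` {1..n}))"
    by (simp add: image_mset_mset_set[OF inj_on_subset[OF permutes_inj[OF \<tau>] subset_UNIV], symmetric]
      multiset.map_comp)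
  also have "\<dots> = m" by (simp only: permutes_image[OF \<tau>] content)
  finally have mset: "image_mset (restrict (i \<circ> \<tau>) {1..n}) (mset_set {1..n}) = m" .
  have "if \<tau> v < v then i v < i (\<tau> v) \<or> i v = i (\<tau> v) \<and> v \<noteq> Suc (block_start (i v)) else i (\<tau> v) \<le> i v"
    if v: "v \<in> {1..n}" for v
  proof (cases "\<tau> v < v")
    case True
    then have le: "i v \<le> i (\<tau> v)" using decr[of "\<tau> v" v] in_n[OF v] v by simp
    have "v \<noteq> Suc (block_start (i v))" if eq: "i v = i (\<tau> v)"
    proof -
      have "block_start (i v) < \<tau> v" using eq eq_iff_block[OF in_n[OF v], of "i v"] by simp
      then show ?thesis using True by linarith
    qed
    then show ?thesis using True le by auto
  next
    case False
    then show ?thesis using decr[of v "\<tau> v"] in_n[OF v] v by simp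
  qed
  then show ?thesis
    unfolding codes_def code_of_def using mset in_n i_in by (auto simp: PiE_def)
qed

lemma rk_code_of:
  assumes "compatible \<tau>"
  shows "case_prod rk (code_of \<tau>) = \<tau>"
proof -
  obtain c E where cE: "code_of \<tau> = (c, E)" by (cases "code_of \<tau>")
  have "\<tau> = rk c E"
    by (rule code.permutation_eq_rank) (use assms cE in \<open>auto simp: compatible_def\<close>)
  then show ?thesis using cE by simp
qed

lemma code_of_rk:
  assumes cE: "(c, E) \<in> codes"
  shows "code_of (rk c E) = (c, E)" "compatible (rk c E)"
proof -
  have "restrict (i \<circ> rk c E) {1..n} v = c v" for v
  proof (cases "v \<in> {1..n}")
    case True
    then show ?thesis using i_rank[OF cE True] by simp
  next
    case False
    have c: "c \<in> {1..n} \<rightarrow>\<^sub>E set_mset m" using cE unfolding codes_def by blast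
    show ?thesis using False by (simp only: restrict_apply PiE_arb[OF c False] if_False)
  qed
  moreover have "{v \<in> {1..n}. rk c E v < v} = E"
    using rank_less_iff_E[OF cE] E_sub[OF cE] by blast
  ultimately show code: "code_of (rk c E) = (c, E)"
    unfolding code_of_def by (simp add: fun_eq_iff)
  show "compatible (rk c E)"
    unfolding compatible_def code using code.rank_permutes code.rank_less_iff by simp
qed

lemma sum_compatible:
  "(\<Sum>\<tau> | compatible \<tau>. f (code_of \<tau>)) = (\<Sum>x\<in>codes. f x)"
proof (rule sum.reindex_bij_witness[of _ "case_prod rk" code_of])
  show "\<And>x. x \<in> codes \<Longrightarrow> code_of (case_prod rk x) = x" using code_of_rk(1) by auto
  show "\<And>x. x \<in> codes \<Longrightarrow> case_prod rk x \<in> {\<tau>. compatible \<tau>}" using code_of_rk(2) by auto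
qed (auto simp: rk_code_of compatible_def code_of_in_codes)

section \<open>Codes with prescribed fixed points\<close>

text \<open>
  The number of fixed points in each block. Sorting the codes by these numbers makes the conditions on a code
  independent at different places.
\<close>

definition run_lengths :: "(nat \<Rightarrow> nat) \<times> nat set \<Rightarrow> nat \<Rightarrow> nat" where
  "run_lengths = (\<lambda>(c, E). \<lambda>b\<in>set_mset m. card {v \<in> {1..n}. i v = b \<and> trailing c E v})"

abbreviation free_end :: "(nat \<Rightarrow> nat) \<Rightarrow> nat \<Rightarrow> nat" where
  "free_end g b \<equiv> block_start b + (count m b - g b)"

text \<open>
  Which letters a place \<open>v\<close> admits, barred or unbarred, when the block of \<open>b\<close> is to end with a run of exactly
  \<open>g b\<close> fixed points. Places after \<open>free_end\<close> carry an unbarred \<open>b\<close>; the place \<open>free_end\<close> itself must not,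
  as it would lengthen the run.
\<close>

definition barred_ok :: "(nat \<Rightarrow> nat) \<Rightarrow> nat \<Rightarrow> nat \<Rightarrow> bool" where
  "barred_ok g v c \<longleftrightarrow> v \<le> free_end g (i v) \<and>
     (i v < c \<or> i v = c \<and> v \<noteq> Suc (block_start (i v)))"

definition plain_ok :: "(nat \<Rightarrow> nat) \<Rightarrow> nat \<Rightarrow> nat \<Rightarrow> bool" where
  "plain_ok g v c \<longleftrightarrow> (if v \<le> free_end g (i v) then c < i v \<or> i v = c \<and> v \<noteq> free_end g (i v) else c = i v)"

lemma same_block:
  assumes "v \<in> {1..n}" "w \<in> {1..n}"
  shows "i w = i v \<longleftrightarrow> block_start (i v) < w \<and> w \<le> block_start (i v) + count m (i v)"
  using eq_iff_block[OF assms(2), of "i v"] .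

lemma block_mem: "block_start b < w \<Longrightarrow> w \<le> block_start b + count m b \<Longrightarrow> w \<in> {1..n}"
  using block_end_le[of b] by auto

lemma block_eq: "{v \<in> {1..n}. i v = b} = {block_start b<..block_start b + count m b}"
proof (rule set_eqI)
  fix v
  show "v \<in> {v \<in> {1..n}. i v = b} \<longleftrightarrow> v \<in> {block_start b<..block_start b + count m b}"
    using eq_iff_block[of v b] block_mem[of b v] by (cases "v \<in> {1..n}") auto
qed

text \<open>
  Fixing the lengths of the final runs decouples the places: what remains is one condition on the letter and bar
  of each place.
\<close>

lemma codes_run_iff:
  assumes c: "c \<in> {1..n} \<rightarrow>\<^sub>E set_mset m" "image_mset c (mset_set {1..n}) = m" and E: "E \<subseteq> {1..n}"
  shows "(\<forall>v\<in>{1..n}. if v \<in> E then barred_ok g v (c v) else plain_ok g v (c v)) \<longleftrightarrow>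
    (c, E) \<in> codes \<and> (\<forall>v\<in>{1..n}. trailing c E v \<longleftrightarrow> free_end g (i v) < v)"
    (is "?lhs \<longleftrightarrow> ?rhs")
proof
  assume L: ?lhs
  have ok: "v \<in> E \<Longrightarrow> barred_ok g v (c v)" "v \<notin> E \<Longrightarrow> plain_ok g v (c v)" if "v \<in> {1..n}" for v
    using L that by auto
  have "if v \<in> E then i v < c v \<or> i v = c v \<and> v \<noteq> Suc (block_start (i v)) else c v \<le> i v"
    if "v \<in> {1..n}" for v
    using ok[OF that] by (auto simp: barred_ok_def plain_ok_def split: if_splits)
  then have "(c, E) \<in> codes"
    unfolding codes_def using c E by simp
  moreover have "trailing c E v \<longleftrightarrow> free_end g (i v) < v" if v: "v \<in> {1..n}" for v
  proof
    assume late: "free_end g (i v) < v"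
    show "trailing c E v" unfolding trailing_def
    proof (intro ballI impI)
      fix w assume w: "w \<in> {1..n}" "v \<le> w \<and> i w = i v"
      then have "\<not> w \<le> free_end g (i w)" using late by simp
      then show "c w = i v \<and> w \<notin> E"
        using ok[OF w(1)] w(2) by (auto simp: barred_ok_def plain_ok_def)
    qed
  next
    assume tr: "trailing c E v"
    show "free_end g (i v) < v"
    proof (rule ccontr)
      assume "\<not> free_end g (i v) < v"
      define w where "w = free_end g (i v)"
      have vw: "v \<le> w" using \<open>\<not> free_end g (i v) < v\<close> by (simp add: w_def)
      have "block_start (i v) < v" using same_block[OF v v] by simp
      then have wb: "block_start (i v) < w" "w \<le> block_start (i v) + count m (i v)"
        using vw by (simp_all add: w_def)
      then have w: "w \<in> {1..n}" by (rule block_mem)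
      then have iw: "i w = i v" using same_block[OF v w] wb by simp
      then have "c w = i v" "w \<notin> E" using tr w vw unfolding trailing_def by auto
      then show False using ok(2)[OF w] iw by (simp add: plain_ok_def w_def)
    qed
  qed
  ultimately show ?rhs by blast
next
  assume R: ?rhs
  then have cE: "(c, E) \<in> codes" and tr: "\<And>v. v \<in> {1..n} \<Longrightarrow> trailing c E v \<longleftrightarrow> free_end g (i v) < v"
    by auto
  show ?lhs
  proof
    fix v assume v: "v \<in> {1..n}"
    show "if v \<in> E then barred_ok g v (c v) else plain_ok g v (c v)"
    proof (cases "v \<in> E")
      case True
      then have "\<not> trailing c E v" using v by (auto simp: trailing_def)
      then have "v \<le> free_end g (i v)" using tr[OF v] by simp
      then show ?thesis
        using True cE_rules(1,2)[OF cE v True] by (auto simp: barred_ok_def)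
    next
      case vE: False
      show ?thesis
      proof (cases "v \<le> free_end g (i v)")
        case True
        have "v \<noteq> free_end g (i v)" if eq: "c v = i v"
        proof
          assume v_eq: "v = free_end g (i v)"
          have "trailing c E v" unfolding trailing_def
          proof (intro ballI impI)
            fix w assume w: "w \<in> {1..n}" "v \<le> w \<and> i w = i v"
            show "c w = i v \<and> w \<notin> E"
            proof (cases "w = v")
              case True
              then show ?thesis using eq vE by simp
            next
              case False
              then have "free_end g (i w) < w" using w v_eq by simp
              then have "trailing c E w" using tr[OF w(1)] by simp
              then show ?thesis using w unfolding trailing_def by auto
            qed
          qed
          then show False using tr[OF v] v_eq by simp
        qed
        then show ?thesis using True vE cE_rules(3)[OF cE v vE] by (auto simp: plain_ok_def)
      next
        case False
        then have "trailing c E v" using tr[OF v] by simp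
        then have "c v = i v" using v unfolding trailing_def by auto
        then show ?thesis using False vE by (simp add: plain_ok_def)
      qed
    qed
  qed
qed

lemma run_lengths_iff:
  assumes g: "g \<in> (\<Pi>\<^sub>E b\<in>set_mset m. {..count m b})"
  shows "run_lengths (c, E) = g \<longleftrightarrow> (\<forall>v\<in>{1..n}. trailing c E v \<longleftrightarrow> free_end g (i v) < v)"
proof
  let ?F = "\<lambda>b. {v \<in> {1..n}. i v = b \<and> trailing c E v}"
  have seg: "?F b = {block_start b + count m b - card (?F b)<..block_start b + count m b}" for b
  proof (rule final_segment)
    show "?F b \<subseteq> {block_start b<..block_start b + count m b}" using block_eq by auto
    fix j k assume k: "k \<in> ?F b" and j: "k \<le> j" "j \<le> block_start b + count m b"
    then have "block_start b < k" using eq_iff_block[of k b] by simp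
    then have jn: "j \<in> {1..n}" using j by (intro block_mem) auto
    have "i j = b" using \<open>block_start b < k\<close> j eq_iff_block[OF jn] by simp
    moreover have "trailing c E j" using k j \<open>i j = b\<close> by (auto simp: trailing_def)
    ultimately show "j \<in> ?F b" using jn by simp
  qed
  {
    assume "run_lengths (c, E) = g"
    then have card: "card (?F b) = g b" if "b \<in># m" for b
      using that by (auto simp: run_lengths_def)
    show "\<forall>v\<in>{1..n}. trailing c E v \<longleftrightarrow> free_end g (i v) < v"
    proof
      fix v assume v: "v \<in> {1..n}"
      have "g (i v) \<le> count m (i v)" using g i_in[OF v] by auto
      then have "?F (i v) = {free_end g (i v)<..block_start (i v) + count m (i v)}"
        using seg[of "i v"] card[OF i_in[OF v]] by simp
      then have "v \<in> ?F (i v) \<longleftrightarrow> v \<in> {free_end g (i v)<..block_start (i v) + count m (i v)}"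
        by (simp only:)
      then show "trailing c E v \<longleftrightarrow> free_end g (i v) < v"
        using v same_block[OF v v] by simp
    qed
  }
  assume R: "\<forall>v\<in>{1..n}. trailing c E v \<longleftrightarrow> free_end g (i v) < v"
  have "run_lengths (c, E) b = g b" for b
  proof (cases "b \<in># m")
    case True
    have "?F b = {v \<in> {1..n}. i v = b} \<inter> {free_end g b<..}" using R by auto
    also have "\<dots> = {free_end g b<..block_start b + count m b}"
      unfolding block_eq by auto
    finally have "card (?F b) = count m b - (count m b - g b)" by simp
    also have "\<dots> = g b" using g True by (auto dest!: PiE_mem)
    finally show ?thesis using True by (simp add: run_lengths_def)
  next
    case False
    then show ?thesis using PiE_arb[OF g False] by (simp add: run_lengths_def)
  qed
  then show "run_lengths (c, E) = g" by (simp add: fun_eq_iff)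
qed

lemma run_lengths_in: "run_lengths x \<in> (\<Pi>\<^sub>E b\<in>set_mset m. {..count m b})"
proof -
  obtain c E where x: "x = (c, E)" by (cases x)
  have "card {v \<in> {1..n}. i v = b \<and> trailing c E v} \<le> count m b" for b
    unfolding card_letter(2)[OF content, symmetric] by (rule card_mono) auto
  then show ?thesis by (simp add: x run_lengths_def)
qed

lemma sum_run_lengths: "(\<Sum>b\<in>set_mset m. run_lengths (c, E) b) = card {v \<in> {1..n}. trailing c E v}"
proof -
  have "card {v \<in> {1..n}. trailing c E v} =
      card (\<Union>b\<in>set_mset m. {v \<in> {1..n}. i v = b \<and> trailing c E v})"
    using i_in by (intro arg_cong[of _ _ card]) auto
  also have "\<dots> = (\<Sum>b\<in>set_mset m. card {v \<in> {1..n}. i v = b \<and> trailing c E v})"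
    by (rule card_UN_disjoint) auto
  finally show ?thesis by (simp add: run_lengths_def)
qed

lemma finite_codes: "finite codes"
proof (rule finite_subset)
  show "codes \<subseteq> ({1..n} \<rightarrow>\<^sub>E set_mset m) \<times> Pow {1..n}" unfolding codes_def by blast
qed (intro finite_cartesian_product finite_PiE; simp)

section \<open>Codes as the terms of a product of linear forms\<close>

definition cell_at :: "'a::comm_ring_1 \<Rightarrow> (nat \<Rightarrow> nat) \<Rightarrow> nat \<Rightarrow> (nat, 'a) mfps" where
  "cell_at t g v = linear_form (\<lambda>c. (if barred_ok g v c then t else 0) + (if plain_ok g v c then 1 else 0))"

lemma prod_over_subset_and_complement:
  assumes "E \<subseteq> V" "finite V"
  shows "(\<Prod>v\<in>E. if P v then t else 0) * (\<Prod>v\<in>V - E. if Q v then 1 else (0::'a::comm_ring_1)) =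
    (if \<forall>v\<in>V. if v \<in> E then P v else Q v then t ^ card E else 0)"
proof (cases "\<forall>v\<in>V. if v \<in> E then P v else Q v")
  case True
  then have "P v" if "v \<in> E" for v using that assms by auto
  then have "(\<Prod>v\<in>E. if P v then t else 0) = (\<Prod>v\<in>E. t)" by (intro prod.cong) simp_all
  moreover have "(\<Prod>v\<in>V - E. if Q v then 1 else (0::'a)) = 1"
    using True by (intro prod.neutral) auto
  ultimately show ?thesis using True by simp
next
  case False
  then obtain v where v: "v \<in> V" "\<not> (if v \<in> E then P v else Q v)" by blast
  have fin: "finite E" "finite (V - E)" using assms finite_subset by auto
  have "(\<Prod>v\<in>E. if P v then t else 0) = 0 \<or> (\<Prod>v\<in>V - E. if Q v then 1 else (0::'a)) = 0"
    using v fin by (cases "v \<in> E") (auto intro!: prod_zero bexI[of _ v])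
  then show ?thesis unfolding if_not_P[OF False] by auto
qed

lemma mcoeff_prod_cell_at:
  assumes g: "g \<in> (\<Pi>\<^sub>E b\<in>set_mset m. {..count m b})"
  shows "mcoeff (\<Prod>v\<in>{1..n}. cell_at t g v) m = (\<Sum>x | x \<in> codes \<and> run_lengths x = g. t ^ card (snd x))"
proof -
  let ?W = "{c. c \<in> {1..n} \<rightarrow>\<^sub>E set_mset m \<and> image_mset c (mset_set {1..n}) = m}"
  let ?ok = "\<lambda>c E. \<forall>v\<in>{1..n}. if v \<in> E then barred_ok g v (c v) else plain_ok g v (c v)"
  have finW: "finite ?W"
    by (rule finite_subset[of _ "{1..n} \<rightarrow>\<^sub>E set_mset m"]) (auto intro!: finite_PiE)
  then have fin: "finite (?W \<times> Pow {1..n})" by (intro finite_cartesian_product) simp_all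
  have "mcoeff (\<Prod>v\<in>{1..n}. cell_at t g v) m = (\<Sum>c\<in>?W. \<Prod>v\<in>{1..n}.
      (if barred_ok g v (c v) then t else 0) + (if plain_ok g v (c v) then 1 else 0))"
    unfolding cell_at_def by (rule mcoeff_prod_linear_form) simp
  also have "\<dots> = (\<Sum>c\<in>?W. \<Sum>E\<in>Pow {1..n}. if ?ok c E then t ^ card E else 0)"
  proof (rule sum.cong[OF refl])
    fix c
    have "(\<Prod>v\<in>{1..n}. (if barred_ok g v (c v) then t else 0) + (if plain_ok g v (c v) then 1 else 0)) =
        (\<Sum>E\<in>Pow {1..n}. (\<Prod>v\<in>E. if barred_ok g v (c v) then t else 0) *
          (\<Prod>v\<in>{1..n} - E. if plain_ok g v (c v) then 1 else 0))"
      by (rule prod_add) simp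
    also have "\<dots> = (\<Sum>E\<in>Pow {1..n}. if ?ok c E then t ^ card E else 0)"
      by (intro sum.cong refl prod_over_subset_and_complement) auto
    finally show "(\<Prod>v\<in>{1..n}. (if barred_ok g v (c v) then t else 0) +
        (if plain_ok g v (c v) then 1 else 0)) = (\<Sum>E\<in>Pow {1..n}. if ?ok c E then t ^ card E else 0)" .
  qed
  also have "\<dots> = (\<Sum>(c, E)\<in>?W \<times> Pow {1..n}. if ?ok c E then t ^ card E else 0)"
    by (rule sum.cartesian_product)
  also have "\<dots> = (\<Sum>x\<in>{x \<in> ?W \<times> Pow {1..n}. case_prod ?ok x}. t ^ card (snd x))"
    by (subst sum.inter_filter[OF fin], rule sum.cong[OF refl]) (simp only: case_prod_unfold)
  also have "{x \<in> ?W \<times> Pow {1..n}. case_prod ?ok x} = {x. x \<in> codes \<and> run_lengths x = g}"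
  proof (rule set_eqI)
    fix x :: "(nat \<Rightarrow> nat) \<times> nat set"
    obtain c E where x: "x = (c, E)" by (cases x)
    have "x \<in> codes \<Longrightarrow> x \<in> ?W \<times> Pow {1..n}"
      unfolding codes_def x by blast
    moreover have "case_prod ?ok x \<longleftrightarrow> x \<in> codes \<and> run_lengths x = g"
      if "x \<in> ?W \<times> Pow {1..n}"
    proof -
      have "c \<in> {1..n} \<rightarrow>\<^sub>E set_mset m" "image_mset c (mset_set {1..n}) = m" "E \<subseteq> {1..n}"
        using that unfolding x by blast+
      from codes_run_iff[OF this, of g] show ?thesis
        unfolding x run_lengths_iff[OF g] by (simp only: prod.case)
    qed
    ultimately show "x \<in> {x \<in> ?W \<times> Pow {1..n}. case_prod ?ok x} \<longleftrightarrow>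
        x \<in> {x. x \<in> codes \<and> run_lengths x = g}" by blast
  qed
  finally show ?thesis .
qed

text \<open>
  Grouped by blocks, the places up to \<open>free_end\<close> give the words without fixed points, and each of the \<open>g b\<close>
  later places gives a factor \<open>x\<^sub>b\<close>.
\<close>

lemma prod_cell_at:
  assumes g: "g \<in> (\<Pi>\<^sub>E b\<in>set_mset m. {..count m b})"
  shows "(\<Prod>v\<in>{1..n}. cell_at t g v) =
    (\<Prod>b\<in>set_mset m. fixfree_block t b (count m b - g b) * mmonom 1 {#b#} ^ g b)"
proof -
  have "(\<Prod>v\<in>{1..n}. cell_at t g v) = (\<Prod>b\<in>set_mset m. \<Prod>v\<in>{v \<in> {1..n}. i v = b}. cell_at t g v)"
    by (rule prod.group[symmetric]) (use i_in in auto)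
  also have "\<dots> = (\<Prod>b\<in>set_mset m. fixfree_block t b (count m b - g b) * mmonom 1 {#b#} ^ g b)"
  proof (rule prod.cong[OF refl])
    fix b assume b: "b \<in> set_mset m"
    define a p where "a = block_start b" and "p = count m b - g b"
    have gb: "g b \<le> count m b" using PiE_mem[OF g b] by simp
    have at: "cell_at t g (Suc (a + q)) = (if q < p then cell t b (q \<noteq> 0) (Suc q \<noteq> p) else mmonom 1 {#b#})"
      if q: "q < count m b" for q
    proof -
      have "Suc (a + q) \<in> {1..n}" by (rule block_mem[of b]) (use q in \<open>auto simp: a_def\<close>)
      then have iv: "i (Suc (a + q)) = b" using eq_iff_block q by (simp add: a_def)
      show ?thesis
      proof (cases "q < p")
        case True
        then show ?thesis
          unfolding cell_at_def cell_def
          by (auto simp: barred_ok_def plain_ok_def iv p_def[symmetric] a_def[symmetric]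
            intro!: arg_cong[of _ _ linear_form])
      next
        case False
        then show ?thesis
          unfolding cell_at_def linear_form_single[symmetric]
          by (auto simp: barred_ok_def plain_ok_def iv p_def[symmetric] a_def[symmetric]
            intro!: arg_cong[of _ _ linear_form])
      qed
    qed
    have "(\<Prod>v\<in>{v \<in> {1..n}. i v = b}. cell_at t g v) = (\<Prod>q<count m b. cell_at t g (Suc (a + q)))"
      unfolding block_eq a_def[symmetric]
      by (rule prod.reindex_bij_witness[of _ "\<lambda>q. Suc (a + q)" "\<lambda>v. v - Suc a"]) auto
    also have "\<dots> = (\<Prod>q<count m b. if q < p then cell t b (q \<noteq> 0) (Suc q \<noteq> p) else mmonom 1 {#b#})"
      by (rule prod.cong[OF refl], rule at) simp
    also have "{..<count m b} = {..<p} \<union> {p..<count m b}" by (auto simp: p_def)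
    also have "(\<Prod>q\<in>{..<p} \<union> {p..<count m b}. if q < p then cell t b (q \<noteq> 0) (Suc q \<noteq> p) else mmonom 1 {#b#}) =
        fixfree_block t b p * mmonom 1 {#b#} ^ card {p..<count m b}"
      by (subst prod.union_disjoint) (auto simp: fixfree_block_def)
    also have "card {p..<count m b} = g b" using gb by (simp add: p_def)
    finally show "(\<Prod>v\<in>{v \<in> {1..n}. i v = b}. cell_at t g v) =
        fixfree_block t b (count m b - g b) * mmonom 1 {#b#} ^ g b" by (simp add: p_def)
  qed
  finally show ?thesis .
qed

text \<open>
  Permutations are replaced by their codes, the codes are grouped by the lengths \<open>g\<close> of their final runs, and for each \<open>g\<close>
  the codes are the terms of a product over the places. Summing over \<open>g\<close> can be done in each block
  separately.
\<close>

lemma sum_compatible_eq_block_product: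
  "(\<Sum>\<tau> | compatible \<tau>. t ^ card {v \<in> {1..n}. \<tau> v < v} * r ^ card {v \<in> {1..n}. \<tau> v = v}) =
   mcoeff (\<Prod>b\<in>set_mset m. block t r b (count m b)) m"
proof -
  let ?G = "\<Pi>\<^sub>E b\<in>set_mset m. {..count m b}"
  let ?w = "\<lambda>x. t ^ card (snd x) * r ^ (\<Sum>b\<in>set_mset m. run_lengths x b)"
  have "(\<Sum>\<tau> | compatible \<tau>. t ^ card {v \<in> {1..n}. \<tau> v < v} * r ^ card {v \<in> {1..n}. \<tau> v = v}) =
      (\<Sum>\<tau> | compatible \<tau>. ?w (code_of \<tau>))"
  proof (rule sum.cong[OF refl])
    fix \<tau> assume "\<tau> \<in> {\<tau>. compatible \<tau>}"
    then have \<tau>: "compatible \<tau>" by simp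
    obtain c E where cE: "code_of \<tau> = (c, E)" by (cases "code_of \<tau>")
    have "(c, E) \<in> codes" using code_of_in_codes[of \<tau>] \<tau> cE by (simp add: compatible_def)
    moreover have "\<tau> = rk c E" using rk_code_of[OF \<tau>] cE by simp
    ultimately have "{v \<in> {1..n}. \<tau> v = v} = {v \<in> {1..n}. trailing c E v}"
      using rank_eq_iff_trailing by blast
    moreover have "{v \<in> {1..n}. \<tau> v < v} = E" using cE by (simp add: code_of_def)
    ultimately show "t ^ card {v \<in> {1..n}. \<tau> v < v} * r ^ card {v \<in> {1..n}. \<tau> v = v} = ?w (code_of \<tau>)"
      by (simp only: cE snd_conv sum_run_lengths)
  qed
  also have "\<dots> = (\<Sum>x\<in>codes. ?w x)" by (rule sum_compatible)
  also have "\<dots> = (\<Sum>g\<in>?G. \<Sum>x | x \<in> codes \<and> run_lengths x = g. ?w x)"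
    by (rule sum.group[symmetric]) (use finite_codes run_lengths_in in \<open>auto intro!: finite_PiE\<close>)
  also have "\<dots> = (\<Sum>g\<in>?G. mcoeff (\<Prod>b\<in>set_mset m.
      fixfree_block t b (count m b - g b) * mmonom r {#b#} ^ g b) m)"
  proof (rule sum.cong[OF refl])
    fix g assume g: "g \<in> ?G"
    have "(\<Sum>x | x \<in> codes \<and> run_lengths x = g. ?w x) =
        r ^ (\<Sum>b\<in>set_mset m. g b) * (\<Sum>x | x \<in> codes \<and> run_lengths x = g. t ^ card (snd x))"
      by (auto simp: sum_distrib_left mult.commute intro!: sum.cong)
    also have "\<dots> = mcoeff (mmonom (r ^ (\<Sum>b\<in>set_mset m. g b)) {#} *
        (\<Prod>b\<in>set_mset m. fixfree_block t b (count m b - g b) * mmonom 1 {#b#} ^ g b)) m"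
      by (simp add: mcoeff_mmonom_mult flip: mcoeff_prod_cell_at[OF g] prod_cell_at[OF g])
    also have "mmonom (r ^ (\<Sum>b\<in>set_mset m. g b)) {#} = (\<Prod>b\<in>set_mset m. mmonom (r ^ g b) {#})"
      by (subst prod_mmonom) (simp_all add: power_sum)
    also have "\<dots> * (\<Prod>b\<in>set_mset m. fixfree_block t b (count m b - g b) * mmonom 1 {#b#} ^ g b) =
        (\<Prod>b\<in>set_mset m. fixfree_block t b (count m b - g b) * mmonom r {#b#} ^ g b)"
      unfolding prod.distrib[symmetric]
      by (rule prod.cong[OF refl], subst mult.left_commute) (simp add: mmonom_power mmonom_mult)
    finally show "(\<Sum>x | x \<in> codes \<and> run_lengths x = g. ?w x) =
        mcoeff (\<Prod>b\<in>set_mset m. fixfree_block t b (count m b - g b) * mmonom r {#b#} ^ g b) m" .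
  qed
  also have "\<dots> = mcoeff (\<Sum>g\<in>?G. \<Prod>b\<in>set_mset m.
      fixfree_block t b (count m b - g b) * mmonom r {#b#} ^ g b) m"
    by (simp only: mcoeff_sum)
  also have "(\<Sum>g\<in>?G. \<Prod>b\<in>set_mset m. fixfree_block t b (count m b - g b) * mmonom r {#b#} ^ g b) =
      (\<Prod>b\<in>set_mset m. block t r b (count m b))"
    unfolding block_def by (rule prod_sum_PiE[symmetric]) auto
  finally show ?thesis .
qed

end

section \<open>Monomials of the quasisymmetric functions\<close>

text \<open>
  The sequences in the definitions of the quasisymmetric functions are extensional functions on
  \<open>{1..n}\<close>; this is the one listing \<open>xs\<close>, with positions counted from \<open>1\<close>.
\<close>

definition list_fun :: "'a list \<Rightarrow> nat \<Rightarrow> 'a" where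
  "list_fun xs = (\<lambda>j\<in>{1..length xs}. xs ! (j - 1))"

lemma list_fun_map:
  assumes "i \<in> extensional {1..n}"
  shows "list_fun (map i [1..<Suc n]) = i"
proof
  fix j
  show "list_fun (map i [1..<Suc n]) j = i j"
  proof (cases "j \<in> {1..n}")
    case True
    then obtain k where "j = Suc k" "k < n" by (cases j) auto
    then show ?thesis by (simp add: list_fun_def del: upt_Suc)
  next
    case False
    then show ?thesis using extensional_arb[OF assms False] by (auto simp: list_fun_def simp del: upt_Suc)
  qed
qed

lemma mset_list_fun: "image_mset (list_fun xs) (mset_set {1..length xs}) = mset xs"
proof -
  have "map (list_fun xs) [1..<Suc (length xs)] = xs"
    by (rule nth_equalityI) (simp_all add: list_fun_def del: upt_Suc)
  then show ?thesis
    by (metis atLeastLessThanSuc_atLeastAtMost mset_map mset_upt)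
qed

lemma mset_map_upt: "mset (map i [1..<Suc n]) = image_mset i (mset_set {1..n})"
  by (simp only: mset_map mset_upt atLeastLessThanSuc_atLeastAtMost)

definition weakly_decreasing :: "nat multiset \<Rightarrow> nat \<Rightarrow> nat" where
  "weakly_decreasing m = list_fun (rev (sorted_list_of_multiset m))"

lemma length_sorted_list_of_multiset [simp]: "length (sorted_list_of_multiset m) = size m"
  using size_mset[of "sorted_list_of_multiset m"] by simp

lemma mset_weakly_decreasing: "image_mset (weakly_decreasing m) (mset_set {1..size m}) = m"
  using mset_list_fun[of "rev (sorted_list_of_multiset m)"] by (simp add: weakly_decreasing_def)

lemma weakly_decreasing_antimono:
  assumes "1 \<le> j" "j \<le> k" "k \<le> size m"
  shows "weakly_decreasing m k \<le> weakly_decreasing m j"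
  using assms sorted_rev_nth_mono[of "rev (sorted_list_of_multiset m)" "j - 1" "k - 1"]
  by (simp add: weakly_decreasing_def list_fun_def)

interpretation wd: arrangement m "size m" "weakly_decreasing m" for m
  by unfold_locales (auto simp: mset_weakly_decreasing weakly_decreasing_antimono simp del: One_nat_def)

lemma weakly_decreasing_unique:
  assumes "i \<in> extensional {1..n}" "\<forall>j\<in>{1..<n}. i j \<ge> i (Suc j)"
    and "image_mset i (mset_set {1..n}) = m"
  shows "n = size m" "i = weakly_decreasing m"
proof -
  let ?xs = "map i [1..<Suc n]"
  have m: "mset ?xs = m" using assms(3) by (simp only: mset_map_upt)
  have "sorted (rev ?xs)"
    unfolding sorted_rev_iff_nth_Suc using assms(2) by (auto simp del: upt_Suc)
  then have "rev ?xs = sorted_list_of_multiset m"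
    by (metis m mset_rev sorted_list_of_multiset_mset sorted_sort_id)
  then have "?xs = rev (sorted_list_of_multiset m)" by (metis rev_rev_ident)
  then show "i = weakly_decreasing m"
    unfolding weakly_decreasing_def using list_fun_map[OF assms(1)] by simp
  show "n = size m" using m by (metis assms(3) card_atLeastAtMost diff_Suc_1 size_image_mset size_mset_set)
qed

lemma weakly_increasing_unique:
  assumes "i \<in> extensional {1..n}" "\<forall>j\<in>{1..<n}. i j \<le> i (Suc j)"
    and "image_mset i (mset_set {1..n}) = m"
  shows "n = size m" "i = list_fun (sorted_list_of_multiset m)"
proof -
  let ?xs = "map i [1..<Suc n]"
  have m: "mset ?xs = m" using assms(3) by (simp only: mset_map_upt)
  have "sorted ?xs"
    unfolding sorted_iff_nth_Suc using assms(2) by (auto simp del: upt_Suc)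
  then have "?xs = sorted_list_of_multiset m"
    by (metis m sorted_list_of_multiset_mset sorted_sort_id)
  then show "i = list_fun (sorted_list_of_multiset m)"
    using list_fun_map[OF assms(1)] by simp
  show "n = size m" using m by (metis assms(3) card_atLeastAtMost diff_Suc_1 size_image_mset size_mset_set)
qed

lemma mcoeff_prod_mvar:
  fixes n :: nat
  shows "mcoeff (\<Prod>j = 1..n. mvar (i j) :: ('v, 'a::comm_ring_1) mfps) m =
    (if image_mset i (mset_set {1..n}) = m then 1 else 0)"
proof -
  have "mvar v = (mmonom 1 {#v#} :: ('v, 'a) mfps)" for v
    by (rule mfps_eqI) (simp add: mvar_def mcoeff_mmonom)
  then have "(\<Prod>j = 1..n. mvar (i j) :: ('v, 'a) mfps) = mmonom 1 (image_mset i (mset_set {1..n}))"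
    using prod_mmonom[of "{1..n}" "\<lambda>_. 1 :: 'a" "\<lambda>j. {#i j#}"]
    by (simp add: sum_singletons del: One_nat_def)
  then show ?thesis by (auto simp: mcoeff_mmonom)
qed

lemma mcoeff_mfps_sum_prod_mvar:
  fixes A :: "(nat \<Rightarrow> 'v) set"
  assumes uniq: "\<And>i. i \<in> A \<Longrightarrow> image_mset i (mset_set {1..n}) = m \<Longrightarrow> i = i0"
  shows "mcoeff (mfps_sum (\<lambda>i. \<Prod>j = 1..n. mvar (i j) :: ('v, 'a::comm_ring_1) mfps) A) m =
    (if i0 \<in> A \<and> image_mset i0 (mset_set {1..n}) = m then 1 else 0)"
proof -
  have "{i \<in> A. mcoeff (\<Prod>j = 1..n. mvar (i j) :: ('v, 'a) mfps) m \<noteq> 0} =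
      (if i0 \<in> A \<and> image_mset i0 (mset_set {1..n}) = m then {i0} else {})"
    unfolding mcoeff_prod_mvar using uniq by (auto split: if_splits)
  then show ?thesis
    unfolding mfps_sum_def mcoeff_Abs_mfps by (simp add: mcoeff_prod_mvar del: One_nat_def)
qed

lemma zero_notin_image:
  fixes n :: nat
  assumes "w \<in> {1..n} \<rightarrow>\<^sub>E {1..}" "image_mset w (mset_set {1..n}) = m"
  shows "(0::nat) \<notin># m"
proof
  assume "0 \<in># m"
  then have "0 \<in> w ` {1..n}"
    by (simp only: assms(2)[symmetric] set_image_mset finite_set_mset_mset_set finite_atLeastAtMost)
  then obtain v where "v \<in> {1..n}" "w v = 0" by auto
  then show False using PiE_mem[OF assms(1), of v] by simp
qed

text \<open>
  Only one monotone sequence has content \<open>m\<close>, so every coefficient is \<open>0\<close> or \<open>1\<close>. The condition on \<open>0\<close> appears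
  because the variables are \<open>x\<^sub>1, x\<^sub>2, \<dots>\<close> whereas the monomials are multisets over all natural numbers.
\<close>

lemma mcoeff_fund_qsym:
  "mcoeff (fund_qsym S n) m = (if size m = n \<and> 0 \<notin># m \<and>
     (\<forall>j\<in>S. weakly_decreasing m (Suc j) < weakly_decreasing m j) then 1 else 0)"
proof -
  let ?A = "{i \<in> {1..n} \<rightarrow>\<^sub>E {1..}.
        (\<forall>j \<in> {1..<n}. i j \<ge> i (Suc j)) \<and> (\<forall>j \<in> S. i j > i (Suc j))}"
  let ?w = "weakly_decreasing m"
  have "mcoeff (fund_qsym S n) m = (if ?w \<in> ?A \<and> image_mset ?w (mset_set {1..n}) = m then 1 else 0)"
    unfolding fund_qsym_def
    by (rule mcoeff_mfps_sum_prod_mvar) (auto intro: weakly_decreasing_unique(2) simp: PiE_def)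
  also have "?w \<in> ?A \<and> image_mset ?w (mset_set {1..n}) = m \<longleftrightarrow>
      size m = n \<and> 0 \<notin># m \<and> (\<forall>j\<in>S. ?w (Suc j) < ?w j)"
  proof
    assume L: "?w \<in> ?A \<and> image_mset ?w (mset_set {1..n}) = m"
    then have "size m = n" by (metis card_atLeastAtMost diff_Suc_1 size_image_mset size_mset_set)
    moreover have "0 \<notin># m" using L zero_notin_image by blast
    ultimately show "size m = n \<and> 0 \<notin># m \<and> (\<forall>j\<in>S. ?w (Suc j) < ?w j)" using L by blast
  next
    assume R: "size m = n \<and> 0 \<notin># m \<and> (\<forall>j\<in>S. ?w (Suc j) < ?w j)"
    then have n: "n = size m" by simp
    have "?w v \<in> {1..}" if "v \<in> {1..n}" for v
    proof -
      have "?w v \<in># m" using wd.i_in[of v m] that unfolding n .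
      then have "?w v \<noteq> 0" using R by (metis (no_types))
      then show ?thesis by simp
    qed
    moreover have "?w \<in> extensional {1..n}"
      unfolding weakly_decreasing_def list_fun_def n by simp
    ultimately have "?w \<in> {1..n} \<rightarrow>\<^sub>E {1..}" by (simp add: PiE_def)
    moreover have "\<forall>j \<in> {1..<n}. ?w j \<ge> ?w (Suc j)"
      using weakly_decreasing_antimono n by simp
    ultimately show "?w \<in> ?A \<and> image_mset ?w (mset_set {1..n}) = m"
      using R mset_weakly_decreasing n by blast
  qed
  finally show ?thesis .
qed

lemma mcoeff_complete_sym: "mcoeff (complete_sym n) m = (if size m = n \<and> 0 \<notin># m then 1 else 0)"
proof -
  let ?A = "{i \<in> {1..n} \<rightarrow>\<^sub>E {1..}. \<forall>j \<in> {1..<n}. i j \<le> i (Suc j)}"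
  let ?w = "list_fun (sorted_list_of_multiset m)"
  have "mcoeff (complete_sym n) m = (if ?w \<in> ?A \<and> image_mset ?w (mset_set {1..n}) = m then 1 else 0)"
    unfolding complete_sym_def
    by (rule mcoeff_mfps_sum_prod_mvar) (auto intro: weakly_increasing_unique(2) simp: PiE_def)
  also have "?w \<in> ?A \<and> image_mset ?w (mset_set {1..n}) = m \<longleftrightarrow> size m = n \<and> 0 \<notin># m"
  proof
    assume L: "?w \<in> ?A \<and> image_mset ?w (mset_set {1..n}) = m"
    then have "size m = n" by (metis card_atLeastAtMost diff_Suc_1 size_image_mset size_mset_set)
    moreover have "0 \<notin># m" using L zero_notin_image by blast
    ultimately show "size m = n \<and> 0 \<notin># m" by blast
  next
    assume R: "size m = n \<and> 0 \<notin># m"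
    then have n: "n = size m" by simp
    have w: "?w v = sorted_list_of_multiset m ! (v - 1)" if "v \<in> {1..n}" for v
      using that n by (simp add: list_fun_def)
    have mset: "image_mset ?w (mset_set {1..n}) = m"
      using mset_list_fun[of "sorted_list_of_multiset m"] n by simp
    have "?w v \<in># m" if "v \<in> {1..n}" for v
      using that by (subst mset[symmetric]) (simp del: One_nat_def)
    then have "?w v \<noteq> 0" if "v \<in> {1..n}" for v
      using that R by (metis (no_types))
    then have "?w v \<in> {1..}" if "v \<in> {1..n}" for v
      using that by (simp add: Suc_le_eq)
    moreover have "?w \<in> extensional {1..n}"
      unfolding list_fun_def n by simp
    ultimately have "?w \<in> {1..n} \<rightarrow>\<^sub>E {1..}" by (simp add: PiE_def)
    moreover have "\<forall>j \<in> {1..<n}. ?w j \<le> ?w (Suc j)"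
      using sorted_nth_mono[OF sorted_sorted_list_of_multiset[of m]] n by (simp add: w)
    ultimately show "?w \<in> ?A \<and> image_mset ?w (mset_set {1..n}) = m"
      using mset by blast
  qed
  finally show ?thesis .
qed

section \<open>Descents of the barred word\<close>

context arrangement
begin

text \<open>
  At a position \<open>j\<close> where \<open>i\<close> does not drop, the keys of \<open>\<sigma> j\<close> and \<open>\<sigma> (j + 1)\<close> compare like the letters of the
  barred word, because \<open>\<sigma> j\<close> is a barred place exactly if \<open>j\<close> is an excedance.
\<close>

lemma key_step:
  assumes \<sigma>: "\<sigma> permutes {1..n}" and j: "j \<in> {1..<n}"
  defines "key \<equiv> case_prod code_key (code_of (inv \<sigma>))"
  shows "key (\<sigma> j) < key (\<sigma> (Suc j)) \<longleftrightarrow> i (Suc j) < i j \<or> j \<notin> DEX n \<sigma>"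
proof -
  have jn: "j \<in> {1..n}" "Suc j \<in> {1..n}" using j by auto
  then have in_n: "\<sigma> j \<in> {1..n}" "\<sigma> (Suc j) \<in> {1..n}" using permutes_in_image[OF \<sigma>] by blast+
  have inv: "inv \<sigma> (\<sigma> k) = k" for k using permutes_inverses(2)[OF \<sigma>] .
  have ne: "\<sigma> j \<noteq> \<sigma> (Suc j)" using permutes_inj[OF \<sigma>] by (simp add: inj_eq)
  have EXC: "k \<in> EXC n \<sigma> \<longleftrightarrow> k < \<sigma> k" if "k \<in> {1..n}" for k
  proof -
    have "\<sigma> k \<le> n" using permutes_in_image[OF \<sigma>, of k] that by simp
    then show ?thesis using that by (auto simp: EXC_def)
  qed
  have le: "i (Suc j) \<le> i j" using decr[of j "Suc j"] j by simp
  have "key (\<sigma> k) = (- int (i k), \<not> k < \<sigma> k, \<sigma> k)" if "\<sigma> k \<in> {1..n}" for k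
    unfolding key_def code_of_def code_key_def using that by (simp add: inv)
  then have "key (\<sigma> j) < key (\<sigma> (Suc j)) \<longleftrightarrow> i (Suc j) < i j \<or>
      (j < \<sigma> j \<and> \<not> Suc j < \<sigma> (Suc j) \<or>
       (j < \<sigma> j \<longleftrightarrow> Suc j < \<sigma> (Suc j)) \<and> \<sigma> j < \<sigma> (Suc j))"
    using in_n le by auto
  also have "(j < \<sigma> j \<and> \<not> Suc j < \<sigma> (Suc j) \<or>
       (j < \<sigma> j \<longleftrightarrow> Suc j < \<sigma> (Suc j)) \<and> \<sigma> j < \<sigma> (Suc j)) \<longleftrightarrow> j \<notin> DEX n \<sigma>"
    unfolding DEX_def bar_word_def using j ne EXC[OF jn(1)] EXC[OF jn(2)] by auto
  finally show ?thesis .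
qed

text \<open>
  Comparing keys at adjacent positions is enough, as the order of keys is transitive.
\<close>

lemma compatible_inv_iff:
  assumes \<sigma>: "\<sigma> permutes {1..n}"
  shows "compatible (inv \<sigma>) \<longleftrightarrow> (\<forall>j\<in>DEX n \<sigma>. i (Suc j) < i j)"
proof -
  let ?key = "case_prod code_key (code_of (inv \<sigma>))"
  have inv: "inv \<sigma> (\<sigma> k) = k" "\<sigma> (inv \<sigma> k) = k" for k using permutes_inverses[OF \<sigma>] by auto
  have DEX: "DEX n \<sigma> \<subseteq> {1..<n}" by (auto simp: DEX_def)
  have "compatible (inv \<sigma>) \<longleftrightarrow> (\<forall>j\<in>{1..<n}. ?key (\<sigma> j) < ?key (\<sigma> (Suc j)))"
  proof
    assume comp: "compatible (inv \<sigma>)"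
    show "\<forall>j\<in>{1..<n}. ?key (\<sigma> j) < ?key (\<sigma> (Suc j))"
    proof
      fix j assume "j \<in> {1..<n}"
      then have "j \<in> {1..n}" "Suc j \<in> {1..n}" by auto
      then have "\<sigma> j \<in> {1..n}" "\<sigma> (Suc j) \<in> {1..n}" using permutes_in_image[OF \<sigma>] by blast+
      moreover have "inv \<sigma> (\<sigma> j) < inv \<sigma> (\<sigma> (Suc j))" by (simp add: inv)
      ultimately show "?key (\<sigma> j) < ?key (\<sigma> (Suc j))"
        using comp unfolding compatible_def by blast
    qed
  next
    assume step: "\<forall>j\<in>{1..<n}. ?key (\<sigma> j) < ?key (\<sigma> (Suc j))"
    have chain: "?key (\<sigma> j) < ?key (\<sigma> k)" if "1 \<le> j" "k \<le> n" "j < k" for j k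
      using that(3,2)
    proof (induction k)
      case (Suc k)
      have less: "?key (\<sigma> k) < ?key (\<sigma> (Suc k))" if "1 \<le> k"
        using step that Suc.prems by simp
      show ?case
      proof (cases "j = k")
        case True
        then show ?thesis using less \<open>1 \<le> j\<close> by simp
      next
        case False
        then have "j < k" using Suc.prems by simp
        then have "?key (\<sigma> j) < ?key (\<sigma> k)" using Suc.IH Suc.prems by simp
        also have "\<dots> < ?key (\<sigma> (Suc k))" using less \<open>j < k\<close> by simp
        finally show ?thesis .
      qed
    qed simp
    show "compatible (inv \<sigma>)"
      unfolding compatible_def
    proof (intro conjI ballI impI)
      show "inv \<sigma> permutes {1..n}" by (rule permutes_inv[OF \<sigma>])
      fix w v assume wv: "w \<in> {1..n}" "v \<in> {1..n}" "inv \<sigma> w < inv \<sigma> v"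
      have "inv \<sigma> w \<in> {1..n}" "inv \<sigma> v \<in> {1..n}"
        using wv permutes_in_image[OF permutes_inv[OF \<sigma>]] by blast+
      then show "?key w < ?key v" using chain[of "inv \<sigma> w" "inv \<sigma> v"] wv by (simp add: inv)
    qed
  qed
  also have "\<dots> \<longleftrightarrow> (\<forall>j\<in>DEX n \<sigma>. i (Suc j) < i j)"
    using key_step[OF \<sigma>] DEX by blast
  finally show ?thesis .
qed

lemma sum_compatible_inv:
  "(\<Sum>\<sigma> | \<sigma> permutes {1..n} \<and> compatible (inv \<sigma>). t ^ exc n \<sigma> * r ^ fixpts n \<sigma>) =
   (\<Sum>\<tau> | compatible \<tau>. t ^ card {v \<in> {1..n}. \<tau> v < v} * r ^ card {v \<in> {1..n}. \<tau> v = v})"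
proof (rule sum.reindex_bij_witness[of _ inv inv])
  fix \<sigma> assume "\<sigma> \<in> {\<sigma>. \<sigma> permutes {1..n} \<and> compatible (inv \<sigma>)}"
  then have \<sigma>: "\<sigma> permutes {1..n}" and "compatible (inv \<sigma>)" by auto
  then show "inv (inv \<sigma>) = \<sigma>" "inv \<sigma> \<in> {\<tau>. compatible \<tau>}"
    by (simp_all add: permutes_inv_inv)
  have inv: "inv \<sigma> (\<sigma> k) = k" "\<sigma> (inv \<sigma> k) = k" for k using permutes_inverses[OF \<sigma>] by auto
  have in_n: "\<sigma> k \<in> {1..n} \<longleftrightarrow> k \<in> {1..n}" for k using permutes_in_image[OF \<sigma>] .
  have "bij_betw \<sigma> (EXC n \<sigma>) {v \<in> {1..n}. inv \<sigma> v < v}"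
  proof (rule bij_betw_byWitness[of _ "inv \<sigma>"])
    show "\<sigma> ` EXC n \<sigma> \<subseteq> {v \<in> {1..n}. inv \<sigma> v < v}"
    proof
      fix v assume "v \<in> \<sigma> ` EXC n \<sigma>"
      then obtain k where "v = \<sigma> k" "k \<in> {1..n}" "k < \<sigma> k" by (auto simp: EXC_def)
      then show "v \<in> {v \<in> {1..n}. inv \<sigma> v < v}" using in_n[of k] inv by simp
    qed
    show "inv \<sigma> ` {v \<in> {1..n}. inv \<sigma> v < v} \<subseteq> EXC n \<sigma>"
    proof
      fix k assume "k \<in> inv \<sigma> ` {v \<in> {1..n}. inv \<sigma> v < v}"
      then obtain v where "k = inv \<sigma> v" "v \<in> {1..n}" "inv \<sigma> v < v" by blast
      then have "\<sigma> k = v" "k < v" "k \<in> {1..n}" using inv in_n[of k] by simp_all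
      then show "k \<in> EXC n \<sigma>" using \<open>v \<in> {1..n}\<close> by (simp add: EXC_def)
    qed
  qed (simp_all add: inv)
  then have "exc n \<sigma> = card {v \<in> {1..n}. inv \<sigma> v < v}"
    unfolding exc_def by (rule bij_betw_same_card)
  moreover have "{v \<in> {1..n}. inv \<sigma> v = v} = {v \<in> {1..n}. \<sigma> v = v}"
    using inv by metis
  ultimately show "t ^ card {v \<in> {1..n}. inv \<sigma> v < v} * r ^ card {v \<in> {1..n}. inv \<sigma> v = v} =
      t ^ exc n \<sigma> * r ^ fixpts n \<sigma>" by (simp only: fixpts_def)
next
  fix \<tau> assume "\<tau> \<in> {\<tau>. compatible \<tau>}"
  then have comp: "compatible \<tau>" and \<tau>: "\<tau> permutes {1..n}" by (simp_all add: compatible_def)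
  show "inv (inv \<tau>) = \<tau>" by (rule permutes_inv_inv[OF \<tau>])
  then show "inv \<tau> \<in> {\<sigma>. \<sigma> permutes {1..n} \<and> compatible (inv \<sigma>)}"
    using comp permutes_inv[OF \<tau>] by simp
qed

end

section \<open>Homogeneous components\<close>

unbundle fps_syntax

text \<open>
  Passes from \<open>\<int>[[x]][[r]][[t]]\<close> to \<open>\<int>[[r]][[t]][[x]]\<close>, a ring isomorphism, so that the coefficient of a
  monomial in \<open>x\<close> is a power series in \<open>t\<close> and \<open>r\<close>.
\<close>

definition regroup :: "('v, 'a::comm_ring_1) mfps fps fps \<Rightarrow> ('v, 'a fps fps) mfps" where
  "regroup P = Abs_mfps (\<lambda>m. Abs_fps (\<lambda>j. Abs_fps (\<lambda>k. mcoeff (P $ j $ k) m)))"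

lemma mcoeff_regroup: "mcoeff (regroup P) m $ j $ k = mcoeff (P $ j $ k) m"
  by (simp add: regroup_def)

lemma regroup_eqI: "regroup P = regroup Q \<Longrightarrow> P = Q"
  by (intro fps_ext mfps_eqI) (metis mcoeff_regroup)

lemma regroup_add: "regroup (P + Q) = regroup P + regroup Q"
  and regroup_diff: "regroup (P - Q) = regroup P - regroup Q"
  and regroup_0: "regroup 0 = 0"
  by (intro mfps_eqI fps_ext; simp add: mcoeff_regroup)+

lemma regroup_sum: "regroup (sum f A) = (\<Sum>x\<in>A. regroup (f x))"
  by (induction A rule: infinite_finite_induct) (simp_all add: regroup_add regroup_0)

lemma regroup_mult:
  fixes P Q :: "('v, 'a::comm_ring_1) mfps fps fps"
  shows "regroup (P * Q) = regroup P * regroup Q"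
proof (intro mfps_eqI fps_ext)
  fix m :: "'v multiset" and j k :: nat
  let ?S = "{(a, b). a + b = m}"
  have "mcoeff (regroup (P * Q)) m $ j $ k = (\<Sum>j'=0..j. \<Sum>k'=0..k. \<Sum>s\<in>?S.
      mcoeff (P $ j' $ k') (fst s) * mcoeff (Q $ (j - j') $ (k - k')) (snd s))"
    by (simp add: mcoeff_regroup fps_mult_nth fps_sum_nth mcoeff_sum mcoeff_mult case_prod_unfold)
  also have "\<dots> = (\<Sum>j'=0..j. \<Sum>s\<in>?S. \<Sum>k'=0..k.
      mcoeff (P $ j' $ k') (fst s) * mcoeff (Q $ (j - j') $ (k - k')) (snd s))"
    by (rule sum.cong[OF refl], rule sum.swap)
  also have "\<dots> = (\<Sum>s\<in>?S. \<Sum>j'=0..j. \<Sum>k'=0..k.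
      mcoeff (P $ j' $ k') (fst s) * mcoeff (Q $ (j - j') $ (k - k')) (snd s))"
    by (rule sum.swap)
  also have "\<dots> = mcoeff (regroup P * regroup Q) m $ j $ k"
    by (simp add: mcoeff_mult fps_sum_nth fps_mult_nth mcoeff_regroup case_prod_unfold)
  finally show "mcoeff (regroup (P * Q)) m $ j $ k = mcoeff (regroup P * regroup Q) m $ j $ k" .
qed

lemma regroup_const:
  "mcoeff (regroup (fps_const (fps_const h))) m = fps_const (fps_const (mcoeff h m))"
  by (intro fps_ext) (simp add: mcoeff_regroup)

lemma regroup_1: "regroup 1 = 1"
  by (intro mfps_eqI fps_ext) (simp add: mcoeff_regroup mcoeff_1)

lemma regroup_t: "regroup fps_X = mmonom fps_X {#}"
  and regroup_r: "regroup (fps_const fps_X) = mmonom (fps_const fps_X) {#}"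
  by (intro mfps_eqI fps_ext; auto simp: mcoeff_regroup mcoeff_mmonom mcoeff_1 fps_X_def)+

lemma regroup_power: "regroup (P ^ n) = regroup P ^ n"
  by (induction n) (simp_all add: regroup_1 regroup_mult)

text \<open>
  The component of degree \<open>n\<close> in \<open>x\<^sub>1, x\<^sub>2, \<dots>\<close>, with \<open>x\<^sub>0\<close> set to \<open>0\<close>. It plays the role of the coefficient of
  \<open>z\<^sup>n\<close>, because the coefficient of \<open>z\<^sup>n\<close> in each series of the theorem is homogeneous of degree \<open>n\<close> in \<open>x\<close>.
\<close>

definition graded_part :: "nat \<Rightarrow> (nat, 'a::comm_ring_1) mfps \<Rightarrow> (nat, 'a) mfps" where
  "graded_part n F = Abs_mfps (\<lambda>m. if size m = n \<and> 0 \<notin># m then mcoeff F m else 0)"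

lemma mcoeff_graded_part: "mcoeff (graded_part n F) m = (if size m = n \<and> 0 \<notin># m then mcoeff F m else 0)"
  by (simp add: graded_part_def)

lemma graded_part_mult: "(\<Sum>k=0..n. graded_part k F * graded_part (n - k) G) = graded_part n (F * G)"
proof (rule mfps_eqI)
  fix m :: "nat multiset"
  let ?S = "{(a, b). a + b = m}"
  have "mcoeff (\<Sum>k=0..n. graded_part k F * graded_part (n - k) G) m =
      (\<Sum>k=0..n. \<Sum>s\<in>?S. mcoeff (graded_part k F) (fst s) * mcoeff (graded_part (n - k) G) (snd s))"
    by (simp add: mcoeff_sum mcoeff_mult case_prod_unfold)
  also have "\<dots> = (\<Sum>s\<in>?S. \<Sum>k=0..n. mcoeff (graded_part k F) (fst s) * mcoeff (graded_part (n - k) G) (snd s))"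
    by (rule sum.swap)
  also have "\<dots> = (\<Sum>s\<in>?S. if size m = n \<and> 0 \<notin># m then mcoeff F (fst s) * mcoeff G (snd s) else 0)"
  proof (rule sum.cong[OF refl])
    fix s assume "s \<in> ?S"
    then obtain a b where s: "s = (a, b)" and m: "m = a + b" by auto
    have "(\<Sum>k=0..n. mcoeff (graded_part k F) a * mcoeff (graded_part (n - k) G) b) =
        (\<Sum>k=0..n. if k = size a then
           (if size a + size b = n \<and> 0 \<notin># a + b then mcoeff F a * mcoeff G b else 0) else 0)"
      by (intro sum.cong) (auto simp: mcoeff_graded_part)
    also have "\<dots> = (if size m = n \<and> 0 \<notin># m then mcoeff F a * mcoeff G b else 0)"
      by (auto simp: m)
    finally show "(\<Sum>k=0..n. mcoeff (graded_part k F) (fst s) * mcoeff (graded_part (n - k) G) (snd s)) =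
        (if size m = n \<and> 0 \<notin># m then mcoeff F (fst s) * mcoeff G (snd s) else 0)"
      by (simp add: s)
  qed
  also have "\<dots> = mcoeff (graded_part n (F * G)) m"
    by (auto simp: mcoeff_graded_part mcoeff_mult case_prod_unfold intro!: sum.neutral)
  finally show "mcoeff (\<Sum>k=0..n. graded_part k F * graded_part (n - k) G) m = mcoeff (graded_part n (F * G)) m" .
qed

section \<open>The generating function identities\<close>

text \<open>
  The value prescribed in degree \<open>0\<close> is the general sum, since the identity is the only permutation of the empty
  set.
\<close>

lemma eulerian_qsym_eq_sum:
  "eulerian_qsym n j k = (\<Sum>\<sigma> \<in> {\<sigma>. \<sigma> permutes {1..n} \<and> exc n \<sigma> = j \<and> fixpts n \<sigma> = k}.
     fund_qsym (DEX n \<sigma>) n)"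
proof (cases "n = 0")
  case True
  have "fund_qsym (DEX 0 id) 0 = 1"
    by (rule mfps_eqI) (auto simp: mcoeff_fund_qsym mcoeff_1 DEX_def)
  moreover have "{\<sigma>. \<sigma> permutes {1..0::nat} \<and> exc 0 \<sigma> = j \<and> fixpts 0 \<sigma> = k} =
      (if j = 0 \<and> k = 0 then {id} else {})"
    by (auto simp: exc_def EXC_def fixpts_def)
  ultimately show ?thesis using True by (simp add: eulerian_qsym_def)
qed (simp add: eulerian_qsym_def)

lemma regroup_eulerian_qsym:
  fixes n :: nat
  defines "Q \<equiv> Abs_fps (\<lambda>j. Abs_fps (\<lambda>k. eulerian_qsym n j k))"
  shows "regroup Q = graded_part n (derangement_series fps_X * all_monomials (fps_const fps_X))"
proof (rule mfps_eqI)
  fix m :: "nat multiset"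
  let ?c = "\<lambda>\<sigma>. \<forall>j\<in>DEX n \<sigma>. weakly_decreasing m (Suc j) < weakly_decreasing m j"
  let ?t = "fps_X :: int fps fps" and ?r = "fps_const fps_X :: int fps fps"
  have fin: "finite {\<sigma>. \<sigma> permutes {1..n}}" by (rule finite_permutations) simp
  show "mcoeff (regroup Q) m = mcoeff (graded_part n (derangement_series ?t * all_monomials ?r)) m"
  proof (cases "size m = n \<and> 0 \<notin># m")
    case False
    then show ?thesis
      by (intro fps_ext)
        (auto simp: mcoeff_regroup mcoeff_graded_part Q_def eulerian_qsym_eq_sum mcoeff_sum mcoeff_fund_qsym)
  next
    case True
    have tr: "(?t ^ a * ?r ^ b) $ j $ k = (if a = j \<and> b = k then 1 else 0)" for a b j k
    proof -
      have "?t ^ a * ?r ^ b = fps_const (fps_X ^ b) * fps_X ^ a"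
        by (simp add: mult.commute flip: fps_const_power)
      then show ?thesis by (auto simp: fps_X_power_iff)
    qed
    have "mcoeff (regroup Q) m = (\<Sum>\<sigma> | \<sigma> permutes {1..n} \<and> ?c \<sigma>. ?t ^ exc n \<sigma> * ?r ^ fixpts n \<sigma>)"
    proof (intro fps_ext)
      fix j k
      have "mcoeff (regroup Q) m $ j $ k =
          (\<Sum>\<sigma> | \<sigma> permutes {1..n} \<and> exc n \<sigma> = j \<and> fixpts n \<sigma> = k. if ?c \<sigma> then 1 else 0)"
        using True by (simp add: mcoeff_regroup Q_def eulerian_qsym_eq_sum mcoeff_sum mcoeff_fund_qsym)
      also have "\<dots> = (\<Sum>\<sigma> | \<sigma> permutes {1..n}. if (exc n \<sigma> = j \<and> fixpts n \<sigma> = k) \<and> ?c \<sigma> then 1 else 0)"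
        by (rule sum.mono_neutral_cong_left) (use fin in auto)
      also have "\<dots> = (\<Sum>\<sigma> | \<sigma> permutes {1..n} \<and> ?c \<sigma>. (?t ^ exc n \<sigma> * ?r ^ fixpts n \<sigma>) $ j $ k)"
        by (rule sum.mono_neutral_cong_right) (use fin in \<open>auto simp: tr\<close>)
      finally show "mcoeff (regroup Q) m $ j $ k =
          (\<Sum>\<sigma> | \<sigma> permutes {1..n} \<and> ?c \<sigma>. ?t ^ exc n \<sigma> * ?r ^ fixpts n \<sigma>) $ j $ k"
        by (simp add: fps_sum_nth)
    qed
    also have "{\<sigma>. \<sigma> permutes {1..n} \<and> ?c \<sigma>} =
        {\<sigma>. \<sigma> permutes {1..size m} \<and> wd.compatible m (inv \<sigma>)}"
      using True wd.compatible_inv_iff by blast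
    also have "(\<Sum>\<sigma> | \<sigma> permutes {1..size m} \<and> wd.compatible m (inv \<sigma>). ?t ^ exc n \<sigma> * ?r ^ fixpts n \<sigma>) =
        mcoeff (derangement_series ?t * all_monomials ?r) m"
    proof -
      have n: "n = size m" using True by simp
      show ?thesis
        unfolding n wd.sum_compatible_inv wd.sum_compatible_eq_block_product
          mcoeff_derangement_times_all ..
    qed
    finally show ?thesis using True by (simp add: mcoeff_graded_part)
  qed
qed

lemma regroup_complete_sym:
  "regroup (P ^ n * fps_const (fps_const (complete_sym n))) =
   graded_part n (all_monomials s)" if "regroup P = mmonom s {#}"
proof (rule mfps_eqI)
  fix m
  show "mcoeff (regroup (P ^ n * fps_const (fps_const (complete_sym n)))) m = mcoeff (graded_part n (all_monomials s)) m"
    by (auto simp: regroup_mult regroup_power that mmonom_power mcoeff_mmonom_mult regroup_const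
        mcoeff_complete_sym mcoeff_graded_part all_monomials_def)
qed

lemma graded_part_monom_mult: "graded_part n (mmonom c {#} * F) = mmonom c {#} * graded_part n F"
  and graded_part_diff: "graded_part n (F - G) = graded_part n F - graded_part n G"
  by (rule mfps_eqI; simp add: mcoeff_graded_part mcoeff_mmonom_mult)+

abbreviation h_const :: "nat \<Rightarrow> xseries fps fps" where
  "h_const n \<equiv> fps_const (fps_const (complete_sym n))"

text \<open>
  The coefficient of \<open>z\<^sup>n\<close> in (left-hand side) times (first denominator): the component of degree \<open>n\<close> of
  \<open>D(t) H(r) (H(t) - t H(1)) = (1 - t) H(r)\<close>.
\<close>

lemma eulerian_qsym_convolution:
  "(\<Sum>i=0..n. Abs_fps (\<lambda>j. Abs_fps (\<lambda>k. eulerian_qsym i j k)) *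
      (fps_X ^ (n - i) * h_const (n - i) - fps_X * h_const (n - i))) =
   (1 - fps_X) * (fps_const fps_X ^ n * h_const n)"
proof (rule regroup_eqI)
  let ?t = "fps_X :: int fps fps" and ?r = "fps_const fps_X :: int fps fps"
  let ?D = "derangement_series ?t" and ?A = "all_monomials :: int fps fps \<Rightarrow> (nat, int fps fps) mfps"
  have h: "regroup (h_const k) = graded_part k (?A 1)" for k
    using regroup_complete_sym[of 1 1 k] by (simp add: regroup_1 mmonom_1)
  have "regroup (\<Sum>i=0..n. Abs_fps (\<lambda>j. Abs_fps (\<lambda>k. eulerian_qsym i j k)) *
      (fps_X ^ (n - i) * h_const (n - i) - fps_X * h_const (n - i))) =
      (\<Sum>i=0..n. graded_part i (?D * ?A ?r) * graded_part (n - i) (?A ?t - mmonom ?t {#} * ?A 1))"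
    by (simp add: regroup_sum regroup_mult[of "Abs_fps _"] regroup_eulerian_qsym regroup_diff
        regroup_complete_sym[OF regroup_t] regroup_mult[of fps_X] regroup_t h graded_part_diff graded_part_monom_mult)
  also have "\<dots> = graded_part n (?A ?r * (?D * (?A ?t - mmonom ?t {#} * ?A 1)))"
    by (simp only: graded_part_mult mult_ac)
  also have "\<dots> = mmonom (1 - ?t) {#} * graded_part n (?A ?r)"
    by (simp only: derangement_series_identity mult.commute[of "?A ?r"] graded_part_monom_mult)
  also have "mmonom (1 - ?t) {#} = regroup (1 - fps_X :: xseries fps fps)"
    by (rule mfps_eqI) (simp add: regroup_diff regroup_1 regroup_t mcoeff_1 mcoeff_mmonom)
  also have "graded_part n (?A ?r) = regroup (fps_const fps_X ^ n * h_const n)"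
    by (rule regroup_complete_sym[OF regroup_r, symmetric])
  finally show "regroup (\<Sum>i=0..n. Abs_fps (\<lambda>j. Abs_fps (\<lambda>k. eulerian_qsym i j k)) *
      (fps_X ^ (n - i) * h_const (n - i) - fps_X * h_const (n - i))) =
      regroup ((1 - fps_X) * (fps_const fps_X ^ n * h_const n))"
    by (simp only: regroup_mult)
qed

lemma complete_sym_0: "complete_sym 0 = 1"
  by (rule mfps_eqI) (auto simp: mcoeff_complete_sym mcoeff_1)

lemma denominator1_nth:
  "((H_gf oo (var_z * var_t)) - var_t * H_gf) $ n = fps_X ^ n * h_const n - fps_X * h_const n"
proof -
  have "var_z * var_t = fps_const fps_X * fps_X" by (simp add: var_z_def var_t_def mult.commute)
  then have 1: "(H_gf oo (var_z * var_t)) $ n = fps_X ^ n * H_gf $ n"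
    by (simp only: fps_nth_compose_linear)
  have 2: "(var_t * H_gf) $ n = fps_X * H_gf $ n"
    by (simp add: var_t_def)
  have 3: "H_gf $ n = h_const n"
    by (simp add: H_gf_def)
  show ?thesis by (simp only: fps_sub_nth 1 2 3)
qed

lemma numerator_nth: "(H_gf oo (var_r * var_z)) $ n = fps_const fps_X ^ n * h_const n"
  by (simp add: H_gf_def var_r_def var_z_def)

lemma one_minus_var_t: "(1 - var_t) * F = fps_const (1 - fps_X) * F"
  by (simp only: var_t_def fps_const_sub[symmetric] fps_const_1_eq_1)

text \<open>
  For \<open>n \<ge> 2\<close> this is \<open>(1 - t) [n-1]\<^sub>t = 1 - t^(n-1)\<close>. In degrees \<open>0\<close> and \<open>1\<close> the coefficients \<open>(t\<^sup>n - t) h\<^sub>n\<close> are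
  \<open>1 - t\<close> and \<open>0\<close>.
\<close>

lemma denominators_proportional:
  "(1 - var_t) * (1 - den_series) = (H_gf oo (var_z * var_t)) - var_t * H_gf"
proof (rule fps_ext)
  fix n :: nat
  consider "n = 0" | "n = 1" | "n \<ge> 2" by linarith
  then show "((1 - var_t) * (1 - den_series)) $ n = ((H_gf oo (var_z * var_t)) - var_t * H_gf) $ n"
  proof cases
    case 3
    let ?t = "fps_X :: xseries fps fps"
    have "((1 - var_t) * (1 - den_series)) $ n = - (?t * ((1 - ?t) * q_bracket (n - 1) ?t) * h_const n)"
      using 3 unfolding one_minus_var_t by (simp add: den_series_def mult_ac)
    also have "(1 - ?t) * q_bracket (n - 1) ?t = 1 - ?t ^ (n - 1)"
      unfolding q_bracket_def by (rule one_diff_power_eq[symmetric])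
    also have "- (?t * (1 - ?t ^ (n - 1)) * h_const n) = ?t ^ n * h_const n - ?t * h_const n"
      using 3 by (cases n) (simp_all add: algebra_simps)
    finally show ?thesis by (simp only: denominator1_nth)
  qed (unfold one_minus_var_t denominator1_nth, simp_all add: den_series_def complete_sym_0)
qed

theorem theorem1p2:
  shows "Abs_fps (\<lambda>n. Abs_fps (\<lambda>j. Abs_fps (\<lambda>k. eulerian_qsym n j k)))
           = (1 - var_t) * (H_gf oo (var_r * var_z)) / ((H_gf oo (var_z * var_t)) - var_t * H_gf)
       \<and> (1 - var_t) * (H_gf oo (var_r * var_z)) / ((H_gf oo (var_z * var_t)) - var_t * H_gf)
           = (H_gf oo (var_r * var_z)) / (1 - den_series)"
proof -
  define G where "G = Abs_fps (\<lambda>n. Abs_fps (\<lambda>j. Abs_fps (\<lambda>k. eulerian_qsym n j k)))"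
  define d where "d = (H_gf oo (var_z * var_t)) - var_t * H_gf"
  define R where "R = H_gf oo (var_r * var_z)"
  define e where "e = 1 - den_series"
  have Gd: "G * d = (1 - var_t) * R"
  proof (rule fps_ext)
    fix n
    have "(G * d) $ n = (\<Sum>i=0..n. Abs_fps (\<lambda>j. Abs_fps (\<lambda>k. eulerian_qsym i j k)) *
        (fps_X ^ (n - i) * h_const (n - i) - fps_X * h_const (n - i)))"
      by (simp only: fps_mult_nth G_def fps_nth_Abs_fps d_def denominator1_nth)
    also have "\<dots> = ((1 - var_t) * R) $ n"
      by (simp only: eulerian_qsym_convolution one_minus_var_t fps_mult_left_const_nth R_def numerator_nth)
    finally show "(G * d) $ n = ((1 - var_t) * R) $ n" .
  qed
  have d: "d * inverse d = 1" and div_d: "F / d = F * inverse d" for F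
    unfolding d_def by (rule denominator1)+
  have e: "e * inverse e = 1" and div_e: "F / e = F * inverse e" for F
    unfolding e_def by (rule denominator2)+
  have ed: "(1 - var_t) * e = d"
    unfolding e_def d_def by (rule denominators_proportional)
  have "(1 - var_t) * R / d = G * (d * inverse d)"
    by (simp add: div_d mult.assoc flip: Gd)
  then have 1: "(1 - var_t) * R / d = G" by (simp add: d)
  have "R / e = R * inverse e * (d * inverse d)" by (simp add: d div_e)
  also have "\<dots> = (1 - var_t) * R * inverse d * (e * inverse e)"
    by (simp only: ed[symmetric] mult_ac)
  also have "\<dots> = (1 - var_t) * R / d" by (simp add: e div_d)
  finally show ?thesis using 1 unfolding G_def d_def R_def e_def by simp
qed

end
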